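(* Let $K\subset\mathbb{R}^n$ be a convex body such that $B_2^n$ is the ellipsoid of minimal volume containing $K$. For every $\varepsilon\in(0,1)$ there exist contact points $x_1,\dots,x_k$ of $K$ and $B_2^n$, with $k\geqslant[(1-\varepsilon)n]$, and there exists an orthogonal projection $P$ of rank $\geqslant k$ such that for all scalars $(a_j)_{j\leqslant k}$ $$\frac{\varepsilon^2}{16}\left(\sum_{j=1}^k|a_j|^2\right)^{\frac12}\leqslant\left\|\sum_{j=1}^ka_jPx_j\right\|_{PK}\leqslant\frac4\varepsilon\sum_{j=1}^k|a_j|.$$
   Context: $[x]$ denotes the integer part of $x$. $B_2^n$ is the closed Euclidean unit ball of $\mathbb{R}^n$. $K$ is not assumed centrally symmetric. A contact point of $K$ and $B_2^n$ is a point lying on the boundaries of both $K$ and $B_2^n$. $P$ is an orthogonal projection in $\mathbb{R}^n$ and $PK$ is the image of $K$, a convex body in the range of $P$. For $y$ in the range of $P$, $\|y\|_{PK}=\inf\{t>0 : y\in t\,PK\}$ is the Minkowski gauge of $PK$ (not necessarily symmetric). *)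

theory Defs
  imports "HOL-Analysis.Analysis"
begin

definition convex_body :: "(real ^ 'n) set \<Rightarrow> bool" where
  "convex_body K \<longleftrightarrow> convex K \<and> compact K \<and> interior K \<noteq> {}"

text \<open>Ellipsoids are non-degenerate and may have an arbitrary centre \<open>c\<close>; since \<open>K\<close> is not
  assumed symmetric, the minimality below is among ellipsoids with all possible centres.\<close>

definition ellipsoid :: "(real ^ 'n) set \<Rightarrow> bool" where
  "ellipsoid E \<longleftrightarrow>
     (\<exists>(A :: real ^ 'n ^ 'n) c. invertible A \<and> E = (\<lambda>x. c + A *v x) ` cball 0 1)"

text \<open>Uniqueness of the minimiser is a theorem (Loewner) and is not part of the definition.\<close>

definition min_volume_ellipsoid :: "(real ^ 'n) set \<Rightarrow> (real ^ 'n) set \<Rightarrow> bool" where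
  "min_volume_ellipsoid E K \<longleftrightarrow>
     ellipsoid E \<and> K \<subseteq> E \<and>
     (\<forall>E'. ellipsoid E' \<and> K \<subseteq> E' \<longrightarrow> measure lebesgue E \<le> measure lebesgue E')"

definition contact_points :: "(real ^ 'n) set \<Rightarrow> (real ^ 'n) set \<Rightarrow> (real ^ 'n) set" where
  "contact_points K L = frontier K \<inter> frontier L"

definition orthogonal_projection :: "(real ^ 'n \<Rightarrow> real ^ 'n) \<Rightarrow> bool" where
  "orthogonal_projection P \<longleftrightarrow>
     linear P \<and> P \<circ> P = P \<and> (\<forall>x y. P x \<bullet> y = x \<bullet> P y)"

text \<open>The infimum is over the reals, hence meaningful only if \<open>y\<close> lies in some positive multiple
  of \<open>C\<close>. This holds for \<open>C = P ` K\<close> and \<open>y\<close> in the range of \<open>P\<close> as soon as \<open>0\<close> is interior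
  to \<open>K\<close>, which is the case when the unit ball is the minimal volume ellipsoid of \<open>K\<close>.\<close>

definition minkowski_gauge :: "(real ^ 'n) set \<Rightarrow> real ^ 'n \<Rightarrow> real" where
  "minkowski_gauge C y = Inf {t. t > 0 \<and> y \<in> (\<lambda>z. t *\<^sub>R z) ` C}"

end

theory Submission
  imports Defs
begin

text \<open>
  Perturbing the minimal ellipsoid yields, for every linear \<open>T\<close>, a contact point \<open>u\<close> with
  \<open>u \<bullet> T u \<le> trace T / n\<close>. This suffices to run the Spielman--Srivastava barrier argument,
  each step of which needs one such \<open>u\<close>, and it produces \<open>N < n\<close> contact points with
  \<open>norm (\<Sum>j. a j x j) \<ge> (1 - sqrt (N / n)) norm a\<close>. (If
  \<open>N = n\<close> is needed, one more point is added, chosen to have a large component orthogonal to the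
  first \<open>n - 1\<close>.) Take \<open>N = L + G\<close>, where
  \<open>L = \<lfloor>(1 - \<epsilon>) n\<rfloor>\<close> and \<open>G\<close> is half of \<open>n - L\<close> rounded up, split the points into \<open>G\<close> groups of
  size at most \<open>2 / \<epsilon> + 2\<close>, and let \<open>P\<close> be the orthogonal projection whose kernel is spanned by the
  sums of the groups. In the range of \<open>P\<close> minus a point of a group is the sum of the others, which
  gives the upper bound although \<open>K\<close> is not symmetric. Dropping one point of each group keeps the
  rest independent, at the cost of a factor \<open>sqrt (4 / \<epsilon>)\<close> in the lower bound; there it is enough to
  estimate the Euclidean norm, since \<open>P K\<close> lies in the unit ball.
\<close>

section \<open>Orthonormal bases and the spectral theorem\<close>

definition orthonormal_basis :: "'a::euclidean_space set \<Rightarrow> bool" where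
  "orthonormal_basis B \<longleftrightarrow> pairwise orthogonal B \<and> (\<forall>e\<in>B. norm e = 1) \<and> span B = UNIV"

text \<open>Free of matrices, so that the barrier argument runs in any Euclidean space. Independence
  of the basis is \<open>operator_trace_orthonormal_basis\<close>, agreement with the matrix trace
  is \<open>operator_trace_eq_trace\<close>.\<close>

definition operator_trace :: "('a::euclidean_space \<Rightarrow> 'a) \<Rightarrow> real" where
  "operator_trace T = (\<Sum>i\<in>Basis. i \<bullet> T i)"

lemma orthonormal_basis_Basis: "orthonormal_basis (Basis :: 'a::euclidean_space set)"
  by (auto simp: orthonormal_basis_def pairwise_def orthogonal_def inner_Basis)

lemma orthonormal_basis_independent: "orthonormal_basis B \<Longrightarrow> independent B"
  unfolding orthonormal_basis_def by (rule pairwise_orthogonal_independent) auto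

lemma orthonormal_basis_finite: "orthonormal_basis B \<Longrightarrow> finite B"
  by (simp add: orthonormal_basis_independent independent_imp_finite)

lemma orthonormal_basis_card:
  fixes B :: "'a::euclidean_space set"
  assumes "orthonormal_basis B" shows "card B = DIM('a)"
  using assms dim_eq_card_independent[OF orthonormal_basis_independent[OF assms]]
  by (metis dim_UNIV dim_span orthonormal_basis_def)

lemma orthonormal_basis_sum:
  assumes "orthonormal_basis B" shows "(\<Sum>e\<in>B. (y \<bullet> e) *\<^sub>R e) = y"
  using assms orthonormal_basis_finite[OF assms]
  by (intro orthonormal_basis_expand) (auto simp: orthonormal_basis_def)

lemma orthonormal_basis_inner:
  assumes "orthonormal_basis B" shows "(\<Sum>e\<in>B. (x \<bullet> e) * (y \<bullet> e)) = x \<bullet> y"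
proof -
  have "x \<bullet> y = x \<bullet> (\<Sum>e\<in>B. (y \<bullet> e) *\<^sub>R e)"
    using orthonormal_basis_sum[OF assms] by simp
  then show ?thesis by (simp add: inner_sum_right mult.commute)
qed

text \<open>Expand \<open>e \<bullet> T e\<close> in coordinates, exchange the sums, and apply
  Parseval in \<open>B\<close> to \<open>i\<close> and \<open>adjoint T i\<close>.\<close>

lemma operator_trace_orthonormal_basis:
  fixes T :: "'a::euclidean_space \<Rightarrow> 'a"
  assumes "linear T" "orthonormal_basis B"
  shows "operator_trace T = (\<Sum>e\<in>B. e \<bullet> T e)"
proof -
  have "(\<Sum>e\<in>B. e \<bullet> T e) = (\<Sum>e\<in>B. \<Sum>i\<in>Basis. (i \<bullet> e) * (adjoint T i \<bullet> e))"
    by (intro sum.cong refl, subst euclidean_inner)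
       (simp add: adjoint_clauses[OF assms(1)] inner_commute)
  also have "\<dots> = (\<Sum>i\<in>Basis. i \<bullet> adjoint T i)"
    by (subst sum.swap) (simp add: orthonormal_basis_inner[OF assms(2)])
  also have "\<dots> = operator_trace T"
    by (simp add: operator_trace_def adjoint_clauses[OF assms(1)] inner_commute)
  finally show ?thesis by simp
qed

text \<open>First-order condition at a minimum: for small \<open>t\<close> of sign opposite to
  \<open>p\<close> the linear term would win. It serves the variational proof of the spectral
  theorem.\<close>

lemma quadratic_nonneg_imp_linear_zero:
  fixes p q :: real
  assumes "\<And>t. 0 \<le> 2 * t * p + t\<^sup>2 * q"
  shows "p = 0"
proof (rule ccontr)
  assume "p \<noteq> 0"
  define r where "r = \<bar>q\<bar> + 1"
  have "0 \<le> 2 * (- p / r) * p + (- p / r)\<^sup>2 * q" by (rule assms)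
  also have "\<dots> = p\<^sup>2 / r * (q / r - 2)"
    by (simp add: power2_eq_square algebra_simps)
  also have "\<dots> < 0"
    using \<open>p \<noteq> 0\<close> by (intro mult_pos_neg) (auto simp: r_def divide_simps)
  finally show False by simp
qed

text \<open>A maximiser \<open>x\<close> of the quadratic form on the unit sphere of
  \<open>S\<close> is an eigenvector: stationarity makes \<open>m *\<^sub>R x - f x\<close>
  orthogonal to \<open>S\<close>, and this vector lies in \<open>S\<close> itself.\<close>

lemma selfadjoint_eigenvector_exists:
  fixes f :: "'a::euclidean_space \<Rightarrow> 'a"
  assumes f: "linear f" "\<And>x y. f x \<bullet> y = x \<bullet> f y"
    and S: "subspace S" "\<And>x. x \<in> S \<Longrightarrow> f x \<in> S" "S \<noteq> {0}"
  obtains x m where "x \<in> S" "norm x = 1" "f x = m *\<^sub>R x"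
proof -
  obtain z where z: "z \<in> S" "z \<noteq> 0" using S(1,3) subspace_0 by blast
  then have ne: "z /\<^sub>R norm z \<in> S \<inter> sphere 0 1"
    using S(1) by (simp add: subspace_scale)
  have "compact (S \<inter> sphere 0 1)"
    using S(1) by (intro closed_Int_compact closed_subspace compact_sphere)
  moreover have "continuous_on (S \<inter> sphere 0 1) (\<lambda>x. x \<bullet> f x)"
    by (intro continuous_on_inner continuous_on_id linear_continuous_on)
       (simp add: f(1) linear_conv_bounded_linear[symmetric])
  ultimately obtain x where x: "x \<in> S" "norm x = 1"
    and max: "\<And>y. y \<in> S \<inter> sphere 0 1 \<Longrightarrow> y \<bullet> f y \<le> x \<bullet> f x"
    using continuous_attains_sup[of "S \<inter> sphere 0 1" "\<lambda>x. x \<bullet> f x"] ne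
    by (metis Int_iff empty_iff mem_sphere_0)
  define m where "m = x \<bullet> f x"
  \<comment> \<open>Homogeneity extends maximality from the sphere to \<open>S\<close>, so that
    \<open>x + t *\<^sub>R h\<close> can be tested without normalising.\<close>
  have bound: "y \<bullet> f y \<le> m * (y \<bullet> y)" if "y \<in> S" for y
  proof (cases "y = 0")
    case False
    have "(y /\<^sub>R norm y) \<bullet> f (y /\<^sub>R norm y) \<le> m"
      unfolding m_def using that False S(1) by (intro max) (simp add: subspace_scale)
    then show ?thesis
      using False by (simp add: linear_scale[OF f(1)] dot_square_norm power2_eq_square field_simps)
  qed (simp add: linear_0[OF f(1)])
  have "(m *\<^sub>R x - f x) \<bullet> h = 0" if h: "h \<in> S" for h
  proof (rule quadratic_nonneg_imp_linear_zero)
    fix t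
    have "0 \<le> m * ((x + t *\<^sub>R h) \<bullet> (x + t *\<^sub>R h)) - (x + t *\<^sub>R h) \<bullet> f (x + t *\<^sub>R h)"
      using bound[of "x + t *\<^sub>R h"] x h S(1) by (simp add: subspace_add subspace_scale)
    also have "\<dots> = 2 * t * ((m *\<^sub>R x - f x) \<bullet> h) + t\<^sup>2 * (m * (h \<bullet> h) - h \<bullet> f h)"
      using x(2) f(2)[of x h] norm_eq_1[of x]
      by (simp add: linear_add[OF f(1)] linear_scale[OF f(1)] inner_simps m_def[symmetric]
          inner_commute[of h "f x"] inner_commute[of h x] power2_eq_square algebra_simps)
    finally show "0 \<le> 2 * t * ((m *\<^sub>R x - f x) \<bullet> h) + t\<^sup>2 * (m * (h \<bullet> h) - h \<bullet> f h)" .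
  qed
  from this[of "m *\<^sub>R x - f x"] have "f x = m *\<^sub>R x"
    using x S by (simp add: subspace_diff subspace_scale)
  with x show thesis by (rule that)
qed

text \<open>Deflation: self-adjointness makes the orthogonal complement of an eigenvector within
  \<open>S\<close> invariant again. Stating this for invariant subspaces permits induction on the
  dimension.\<close>

lemma selfadjoint_orthonormal_eigenbasis_subspace:
  fixes f :: "'a::euclidean_space \<Rightarrow> 'a"
  assumes f: "linear f" "\<And>x y. f x \<bullet> y = x \<bullet> f y"
    and S: "subspace S" "\<And>x. x \<in> S \<Longrightarrow> f x \<in> S"
  shows "\<exists>B. pairwise orthogonal B \<and> (\<forall>e\<in>B. norm e = 1) \<and> span B = S \<and> (\<forall>e\<in>B. \<exists>m. f e = m *\<^sub>R e)"
  using S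
proof (induction "dim S" arbitrary: S rule: less_induct)
  case less
  show ?case
  proof (cases "S = {0}")
    case True
    then show ?thesis by (intro exI[of _ "{}"]) auto
  next
    case False
    obtain x m where x: "x \<in> S" "norm x = 1" "f x = m *\<^sub>R x"
      using selfadjoint_eigenvector_exists[OF f less.prems False] .
    define S' where "S' = {y \<in> S. x \<bullet> y = 0}"
    have S': "subspace S'"
      using less.prems(1) by (auto simp: S'_def subspace_def inner_simps)
    have "x \<notin> S'" using x norm_eq_1[of x] by (auto simp: S'_def)
    moreover have "S' \<subseteq> S" by (auto simp: S'_def)
    ultimately have "S' \<subset> S" using x by blast
    then have "dim S' < dim S"
      using S' less.prems(1) by (metis dim_psubset span_eq_iff)
    moreover have "f y \<in> S'" if "y \<in> S'" for y
      using that less.prems(2) f(2)[of x y] x(3) by (simp add: S'_def)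
    ultimately obtain B where B: "pairwise orthogonal B" "\<forall>e\<in>B. norm e = 1" "span B = S'"
      "\<forall>e\<in>B. \<exists>m. f e = m *\<^sub>R e"
      using less.hyps[of S'] S' by blast
    have "B \<subseteq> S'" using B(3) span_superset by blast
    have "span (insert x B) = S"
    proof
      show "span (insert x B) \<subseteq> S"
        using \<open>B \<subseteq> S'\<close> \<open>S' \<subset> S\<close> x(1) less.prems(1) by (intro span_minimal) auto
      show "S \<subseteq> span (insert x B)"
      proof
        fix y assume "y \<in> S"
        then have "y - (x \<bullet> y) *\<^sub>R x \<in> span B"
          using B(3) x less.prems(1) norm_eq_1[of x]
          by (simp add: S'_def subspace_diff subspace_scale inner_simps)
        then show "y \<in> span (insert x B)"
          by (metis span_breakdown_eq)
      qed
    qed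
    moreover have "pairwise orthogonal (insert x B)"
      using B(1) \<open>B \<subseteq> S'\<close> by (auto simp: pairwise_insert S'_def orthogonal_def inner_commute)
    ultimately show ?thesis using B x by (intro exI[of _ "insert x B"]) auto
  qed
qed

lemma selfadjoint_orthonormal_eigenbasis:
  fixes f :: "'a::euclidean_space \<Rightarrow> 'a"
  assumes "linear f" "\<And>x y. f x \<bullet> y = x \<bullet> f y"
  obtains B l where "orthonormal_basis B" "\<And>e. e \<in> B \<Longrightarrow> f e = l e *\<^sub>R e"
proof -
  obtain B where B: "pairwise orthogonal B" "\<forall>e\<in>B. norm e = 1" "span B = UNIV"
    and "\<forall>e\<in>B. \<exists>m. f e = m *\<^sub>R e"
    using selfadjoint_orthonormal_eigenbasis_subspace[OF assms subspace_UNIV] by auto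
  then obtain l where "\<forall>e\<in>B. f e = l e *\<^sub>R e" by (auto dest!: bchoice)
  with B show thesis by (intro that[of B l]) (auto simp: orthonormal_basis_def)
qed

section \<open>The barrier method\<close>

text \<open>With the \<open>x j\<close> as columns of a matrix \<open>X\<close> this is
  \<open>X X^T\<close>, whose nonzero eigenvalues are those of the Gram matrix
  \<open>X^T X\<close>.\<close>

definition frame_operator :: "(nat \<Rightarrow> 'a::euclidean_space) \<Rightarrow> nat \<Rightarrow> 'a \<Rightarrow> 'a" where
  "frame_operator x k y = (\<Sum>j<k. (x j \<bullet> y) *\<^sub>R x j)"

lemma linear_frame_operator: "linear (frame_operator x k)"
  unfolding frame_operator_def
  by (intro linearI)
     (simp_all add: inner_simps scaleR_add_left sum.distrib scaleR_sum_right)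

lemma frame_operator_selfadjoint: "frame_operator x k y \<bullet> z = y \<bullet> frame_operator x k z"
  unfolding frame_operator_def
  by (simp add: inner_sum_left inner_sum_right inner_commute mult.commute)

lemma inner_frame_operator: "y \<bullet> frame_operator x k y = (\<Sum>j<k. (x j \<bullet> y)\<^sup>2)"
  unfolding frame_operator_def
  by (simp add: inner_sum_right inner_commute power2_eq_square)

text \<open>All eigenvalues of the Gram matrix exceed \<open>b\<close>. Strictness keeps
  \<open>l e - b\<close> away from zero, and \<open>k = 0\<close> holds vacuously, which starts the
  induction.\<close>

definition riesz_bound :: "real \<Rightarrow> (nat \<Rightarrow> 'a::euclidean_space) \<Rightarrow> nat \<Rightarrow> bool" where
  "riesz_bound b x k \<longleftrightarrow>
     (\<forall>a. (\<exists>j<k. a j \<noteq> 0) \<longrightarrow> b * (\<Sum>j<k. (a j)\<^sup>2) < (norm (\<Sum>j<k. a j *\<^sub>R x j))\<^sup>2)"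

lemma riesz_bound_le:
  assumes "riesz_bound b x k"
  shows "b * (\<Sum>j<k. (a j)\<^sup>2) \<le> (norm (\<Sum>j<k. a j *\<^sub>R x j))\<^sup>2"
proof (cases "\<exists>j<k. a j \<noteq> 0")
  case True
  then show ?thesis using assms unfolding riesz_bound_def by (meson less_imp_le)
next
  case False
  then have "(\<Sum>j<k. (a j)\<^sup>2) = 0" by (intro sum.neutral) auto
  then show ?thesis by simp
qed

text \<open>Test the bound on the coefficients \<open>x j \<bullet> e\<close>: their squares sum to
  \<open>l\<close> and the combination is \<open>l *\<^sub>R e\<close>, so
  \<open>b * l < l * l\<close> unless \<open>l = 0\<close>.\<close>

lemma riesz_bound_eigenvalue:
  assumes "riesz_bound b x k" "frame_operator x k e = l *\<^sub>R e" "norm e = 1"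
  shows "l = 0 \<or> b < l"
proof (cases "l = 0")
  case False
  have l: "(\<Sum>j<k. (x j \<bullet> e)\<^sup>2) = l"
    using inner_frame_operator[of e x k] assms(2,3) norm_eq_1[of e] by simp
  then have "\<exists>j<k. x j \<bullet> e \<noteq> 0"
    using False by (metis (no_types, lifting) lessThan_iff power_zero_numeral sum.neutral)
  then have "b * (\<Sum>j<k. (x j \<bullet> e)\<^sup>2) < (norm (\<Sum>j<k. (x j \<bullet> e) *\<^sub>R x j))\<^sup>2"
    using assms(1) unfolding riesz_bound_def by (elim allE[of _ "\<lambda>j. x j \<bullet> e"]) auto
  also have "\<dots> = l\<^sup>2"
    using assms(2,3) by (simp add: frame_operator_def)
  finally have "b * l < l * l" unfolding l by (simp only: power2_eq_square)
  moreover have "l \<ge> 0" using l by (metis sum_nonneg zero_le_power2)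
  ultimately show ?thesis using False by simp
qed simp

text \<open>Eigenvectors with nonzero eigenvalue lie in the span of the \<open>k\<close> vectors, so
  at most \<open>k\<close> of them belong to \<open>B\<close>.\<close>

lemma frame_operator_kernel_card:
  fixes x :: "nat \<Rightarrow> 'a::euclidean_space"
  assumes B: "orthonormal_basis B" and l: "\<And>e. e \<in> B \<Longrightarrow> frame_operator x k e = l e *\<^sub>R e"
  shows "DIM('a) \<le> card {e \<in> B. l e = 0} + k"
proof -
  let ?N = "{e \<in> B. l e \<noteq> 0}"
  have "e \<in> span (x ` {..<k})" if "e \<in> ?N" for e
  proof -
    have "frame_operator x k e \<in> span (x ` {..<k})"
      unfolding frame_operator_def by (intro span_sum span_scale span_base) auto
    then have "(1 / l e) *\<^sub>R (l e *\<^sub>R e) \<in> span (x ` {..<k})"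
      using that l by (metis (mono_tags, lifting) mem_Collect_eq span_scale)
    then show ?thesis using that by simp
  qed
  moreover have "independent ?N"
    using orthonormal_basis_independent[OF B] by (rule independent_mono) auto
  ultimately have "card ?N \<le> card (x ` {..<k})"
    using independent_span_bound[of "x ` {..<k}" ?N] by blast
  also have "\<dots> \<le> k" using card_image_le[of "{..<k}" x] by simp
  finally have "card ?N \<le> k" .
  moreover have "B = {e \<in> B. l e = 0} \<union> ?N" by auto
  then have "card B \<le> card {e \<in> B. l e = 0} + card ?N"
    using card_Un_le[of "{e \<in> B. l e = 0}" ?N] by simp
  ultimately show ?thesis using orthonormal_basis_card[OF B] by simp
qed

text \<open>The left side is the trace of the squared resolvent at the new barrier
  \<open>c = b - d\<close>. Only zero eigenvalues let it exceed \<open>q\<close>, each by at most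
  \<open>d / (b * c\<^sup>2)\<close>. If there are \<open>z\<close> of them, \<open>q\<close> is at
  least \<open>z / (b * c)\<close>, and \<open>b \<le> d * z\<close> bounds the total excess by
  \<open>d\<^sup>2 * q\<^sup>2\<close>.\<close>

lemma barrier_shift:
  fixes l :: "'b \<Rightarrow> real"
  assumes fin: "finite B" and l: "\<And>e. e \<in> B \<Longrightarrow> l e = 0 \<or> b < l e"
    and b: "0 < b - d" "0 < d" "b \<le> d * real (card {e \<in> B. l e = 0})"
  defines "q \<equiv> \<Sum>e\<in>B. 1 / ((l e - b) * (l e - (b - d)))"
  shows "(\<Sum>e\<in>B. 1 / (l e - (b - d))\<^sup>2) \<le> q + d\<^sup>2 * q\<^sup>2"
proof -
  define c where "c = b - d"
  define z where "z = real (card {e \<in> B. l e = 0})"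
  have c: "0 < c" "0 < b" "c < b" using b by (auto simp: c_def)
  have z: "z \<ge> 0" "b \<le> d * z" using b by (auto simp: z_def)
  have sumz: "(\<Sum>e\<in>B. if l e = 0 then t else 0) = z * t" for t :: real
    using fin by (simp add: z_def sum.inter_filter[symmetric])
  have "(\<Sum>e\<in>B. 1 / (l e - c)\<^sup>2) - q
      = (\<Sum>e\<in>B. 1 / (l e - c)\<^sup>2 - 1 / ((l e - b) * (l e - c)))"
    by (simp add: q_def c_def sum_subtractf)
  also have "\<dots> \<le> (\<Sum>e\<in>B. if l e = 0 then d / (b * c\<^sup>2) else 0)"
  proof (rule sum_mono)
    fix e assume "e \<in> B"
    then consider "l e = 0" | "b < l e" using l by blast
    then show "1 / (l e - c)\<^sup>2 - 1 / ((l e - b) * (l e - c)) \<le> (if l e = 0 then d / (b * c\<^sup>2) else 0)"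
    proof cases
      case 1
      have "d = b - c" by (simp add: c_def)
      moreover have "1 / c\<^sup>2 - 1 / (b * c) = (b - c) / (b * c\<^sup>2)"
        using c by (simp add: field_simps power2_eq_square)
      ultimately show ?thesis using 1 by simp
    next
      case 2
      then have "(l e - b) * (l e - c) \<le> (l e - c)\<^sup>2"
        using c by (simp add: power2_eq_square)
      then have "1 / (l e - c)\<^sup>2 \<le> 1 / ((l e - b) * (l e - c))"
        using 2 c by (intro divide_left_mono) auto
      then show ?thesis using 2 c by simp
    qed
  qed
  also have "\<dots> = z * (d / (b * c\<^sup>2))" by (rule sumz)
  also have "\<dots> \<le> d\<^sup>2 * (z / (b * c))\<^sup>2"
  proof -
    have "z * (d / (b * c\<^sup>2)) = b * (z * d / (b\<^sup>2 * c\<^sup>2))"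
      using c by (simp add: power2_eq_square)
    also have "\<dots> \<le> d * z * (z * d / (b\<^sup>2 * c\<^sup>2))"
      using z b by (intro mult_right_mono) auto
    finally show ?thesis by (simp add: power2_eq_square algebra_simps)
  qed
  also have "\<dots> \<le> d\<^sup>2 * q\<^sup>2"
  proof (intro mult_left_mono power_mono)
    have "z / (b * c) = (\<Sum>e\<in>B. if l e = 0 then 1 / (b * c) else 0)" by (simp add: sumz)
    also have "\<dots> \<le> q"
      unfolding q_def c_def[symmetric]
    proof (rule sum_mono)
      fix e assume "e \<in> B"
      then consider "l e = 0" | "b < l e" using l by blast
      then show "(if l e = 0 then 1 / (b * c) else 0) \<le> 1 / ((l e - b) * (l e - c))"
        using c by cases auto
    qed
    finally show "z / (b * c) \<le> q" .
  qed (use z c in auto)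
  finally show ?thesis by (simp add: c_def)
qed

text \<open>The sum is the trace of the resolvent of the frame operator at the barrier
  \<open>b\<close>, written through an eigenbasis. A zero eigenvalue contributes
  \<open>- 1 / b\<close>, one above \<open>b\<close> a positive term that blows up near
  \<open>b\<close>; the bound \<open>- h\<close> thus keeps nonzero eigenvalues away from the
  barrier.\<close>

definition barrier_state :: "real \<Rightarrow> real \<Rightarrow> (nat \<Rightarrow> 'a::euclidean_space) \<Rightarrow> nat \<Rightarrow> bool" where
  "barrier_state h b x k \<longleftrightarrow> riesz_bound b x k \<and>
     (\<exists>B l. orthonormal_basis B \<and> (\<forall>e\<in>B. frame_operator x k e = l e *\<^sub>R e) \<and>
        (\<Sum>e\<in>B. 1 / (l e - b)) \<le> - h)"

text \<open>Supplies the resolvent of the frame operator through its action on an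
  eigenbasis.\<close>

lemma diagonal_operator:
  fixes B :: "'a::euclidean_space set" and v :: "'a \<Rightarrow> real"
  assumes B: "orthonormal_basis B" and M_def: "\<And>y. M y = (\<Sum>e\<in>B. (v e * (y \<bullet> e)) *\<^sub>R e)"
  shows "linear M" and "\<And>y z. M y \<bullet> z = y \<bullet> M z"
    and "\<And>e. e \<in> B \<Longrightarrow> M e = v e *\<^sub>R e"
proof -
  show "linear M" unfolding M_def
    by (intro linearI) (simp_all add: inner_simps algebra_simps sum.distrib scaleR_sum_right)
  show sa: "M y \<bullet> z = y \<bullet> M z" for y z
    unfolding M_def by (simp add: inner_sum_left inner_sum_right inner_commute algebra_simps)
  fix e assume e: "e \<in> B"
  have "f \<bullet> e = (if f = e then 1 else 0)" if "f \<in> B" for f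
    using B that e by (auto simp: orthonormal_basis_def pairwise_def orthogonal_def norm_eq_1)
  then have "M e = (\<Sum>f\<in>B. if f = e then v e *\<^sub>R e else 0)"
    unfolding M_def by (intro sum.cong) (auto simp: inner_commute)
  then show "M e = v e *\<^sub>R e"
    using e orthonormal_basis_finite[OF B] by simp
qed

text \<open>Completing the square with the vector \<open>w\<close> solving \<open>A w - c w = u\<close>, where \<open>A\<close> is the frame
  operator, shows that the Schur complement of the new entry is \<open>- c (1 + u \<bullet> w)\<close>.\<close>

lemma riesz_bound_extend:
  assumes x: "riesz_bound b x k" and c: "0 < c" "c < b"
    and w: "frame_operator x k w - c *\<^sub>R w = u" and neg: "1 + u \<bullet> w < 0"
  shows "riesz_bound c (x(k := u)) (Suc k)"
  unfolding riesz_bound_def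
proof (intro allI impI)
  fix a :: "nat \<Rightarrow> real"
  assume nz: "\<exists>j<Suc k. a j \<noteq> 0"
  define t where "t = a k"
  define r where "r j = a j + t * (x j \<bullet> w)" for j
  define X where "X = (\<Sum>j<k. r j *\<^sub>R x j)"
  have Aw: "frame_operator x k w = u + c *\<^sub>R w" using w by (simp add: algebra_simps)
  have "X = (\<Sum>j<k. a j *\<^sub>R x j) + t *\<^sub>R frame_operator x k w"
    by (simp add: X_def r_def frame_operator_def scaleR_add_left sum.distrib scaleR_sum_right)
  then have Xa: "(\<Sum>j<k. a j *\<^sub>R x j) + t *\<^sub>R u = X - (t * c) *\<^sub>R w"
    by (simp add: Aw algebra_simps)
  have wX: "(\<Sum>j<k. r j * (x j \<bullet> w)) = w \<bullet> X"
    by (simp add: X_def inner_sum_right inner_commute)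
  have ww: "(\<Sum>j<k. (x j \<bullet> w)\<^sup>2) = u \<bullet> w + c * (w \<bullet> w)"
    using inner_frame_operator[of w x k] by (simp add: Aw inner_simps inner_commute)
  have "(\<Sum>j<k. (a j)\<^sup>2) = (\<Sum>j<k. (r j)\<^sup>2 - 2 * t * (r j * (x j \<bullet> w)) + t\<^sup>2 * (x j \<bullet> w)\<^sup>2)"
    by (intro sum.cong) (auto simp: r_def power2_eq_square algebra_simps)
  also have "\<dots> = (\<Sum>j<k. (r j)\<^sup>2) - 2 * t * (w \<bullet> X) + t\<^sup>2 * (u \<bullet> w + c * (w \<bullet> w))"
    by (simp add: sum.distrib sum_subtractf sum_distrib_left[symmetric] wX ww)
  finally have sq: "(\<Sum>j<k. (a j)\<^sup>2) =
    (\<Sum>j<k. (r j)\<^sup>2) - 2 * t * (w \<bullet> X) + t\<^sup>2 * (u \<bullet> w + c * (w \<bullet> w))" .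
  have "(norm (X - (t * c) *\<^sub>R w))\<^sup>2 = (norm X)\<^sup>2 - 2 * t * c * (w \<bullet> X) + t\<^sup>2 * c\<^sup>2 * (w \<bullet> w)"
    unfolding power2_norm_eq_inner
    by (simp add: inner_diff_left inner_diff_right inner_commute power2_eq_square algebra_simps)
  then have key: "(norm ((\<Sum>j<k. a j *\<^sub>R x j) + t *\<^sub>R u))\<^sup>2 - c * ((\<Sum>j<k. (a j)\<^sup>2) + t\<^sup>2)
      = ((norm X)\<^sup>2 - c * (\<Sum>j<k. (r j)\<^sup>2)) + c * t\<^sup>2 * - (1 + u \<bullet> w)"
    unfolding Xa sq by (simp add: power2_eq_square algebra_simps)
  have cr: "c * (\<Sum>j<k. (r j)\<^sup>2) \<le> b * (\<Sum>j<k. (r j)\<^sup>2)"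
    using c by (intro mult_right_mono sum_nonneg) auto
  \<comment> \<open>Strictness comes from the old bound if \<open>t = 0\<close>, when
    \<open>r\<close> and \<open>a\<close> agree, and from the Schur complement otherwise.\<close>
  have "0 < ((norm X)\<^sup>2 - c * (\<Sum>j<k. (r j)\<^sup>2)) + c * t\<^sup>2 * - (1 + u \<bullet> w)"
  proof (cases "t = 0")
    case True
    then have "\<exists>j<k. r j \<noteq> 0" using nz by (auto simp: r_def t_def less_Suc_eq)
    then have "b * (\<Sum>j<k. (r j)\<^sup>2) < (norm X)\<^sup>2"
      using x unfolding riesz_bound_def X_def by blast
    then show ?thesis using cr True by simp
  next
    case False
    then have "0 < c * t\<^sup>2 * - (1 + u \<bullet> w)"
      using c neg by (intro mult_pos_pos) auto
    moreover have "b * (\<Sum>j<k. (r j)\<^sup>2) \<le> (norm X)\<^sup>2"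
      unfolding X_def by (rule riesz_bound_le[OF x])
    ultimately show ?thesis using cr by linarith
  qed
  then have "c * ((\<Sum>j<k. (a j)\<^sup>2) + t\<^sup>2) < (norm ((\<Sum>j<k. a j *\<^sub>R x j) + t *\<^sub>R u))\<^sup>2"
    using key by linarith
  then show "c * (\<Sum>j<Suc k. (a j)\<^sup>2) < (norm (\<Sum>j<Suc k. a j *\<^sub>R (x(k := u)) j))\<^sup>2"
    by (simp add: t_def)
qed

text \<open>Lowering the barrier by \<open>d\<close> lowers the potential by \<open>d * q\<close>;
  adding \<open>u\<close> raises it by \<open>- (w \<bullet> w) / (1 + g)\<close>. One quadratic
  inequality in \<open>u\<close> yields both \<open>1 + g < 0\<close> and that this rise is at most
  \<open>d * q\<close>, and the hypothesis on \<open>C\<close> finds such a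
  \<open>u\<close>.\<close>

lemma barrier_step:
  fixes C :: "'a::euclidean_space set"
  assumes C: "\<And>T. linear T \<Longrightarrow> \<exists>u\<in>C. u \<bullet> T u \<le> operator_trace T / DIM('a)"
    and unit: "\<And>u. u \<in> C \<Longrightarrow> norm u = 1"
    and st: "barrier_state (DIM('a) + 1 / d) b x k"
    and b: "0 < b - d" "0 < d" "b \<le> d * (real DIM('a) - real k)"
  shows "\<exists>u\<in>C. barrier_state (DIM('a) + 1 / d) (b - d) (x(k := u)) (Suc k)"
proof -
  define c where "c = b - d"
  have c: "0 < c" "c < b" "0 < b" using b by (auto simp: c_def)
  obtain B l where B: "orthonormal_basis B" and l: "\<And>e. e \<in> B \<Longrightarrow> frame_operator x k e = l e *\<^sub>R e"
    and pot: "(\<Sum>e\<in>B. 1 / (l e - b)) \<le> - (DIM('a) + 1 / d)" and rb: "riesz_bound b x k"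
    using st unfolding barrier_state_def by blast
  have finB: "finite B" by (rule orthonormal_basis_finite[OF B])
  have unitB: "norm e = 1" if "e \<in> B" for e using B that by (simp add: orthonormal_basis_def)
  have lb: "l e = 0 \<or> b < l e" if "e \<in> B" for e
    using riesz_bound_eigenvalue[OF rb l unitB] that by blast
  then have lc: "l e - c \<noteq> 0" "l e - b \<noteq> 0" if "e \<in> B" for e using that c by force+
  define v where "v e = 1 / (l e - c)" for e
  \<comment> \<open>\<open>M\<close> is the inverse of the frame operator minus
    \<open>c\<close>.\<close>
  define M where "M y = (\<Sum>e\<in>B. (v e * (y \<bullet> e)) *\<^sub>R e)" for y
  note M = diagonal_operator[OF B M_def]
  interpret M: linear M by (rule M(1))
  interpret A: linear "frame_operator x k" by (rule linear_frame_operator)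
  have AM: "frame_operator x k (M y) - c *\<^sub>R M y = y" for y
  proof -
    have "frame_operator x k (M y) - c *\<^sub>R M y = (\<Sum>e\<in>B. ((l e - c) * v e * (y \<bullet> e)) *\<^sub>R e)"
      unfolding M_def A.sum scaleR_sum_right sum_subtractf[symmetric]
      by (intro sum.cong refl) (simp add: A.scale l algebra_simps)
    also have "\<dots> = (\<Sum>e\<in>B. (y \<bullet> e) *\<^sub>R e)"
      using lc by (intro sum.cong refl) (simp add: v_def)
    finally show ?thesis by (simp add: orthonormal_basis_sum[OF B])
  qed
  define q where "q = (\<Sum>e\<in>B. 1 / ((l e - b) * (l e - c)))"
  define P where "P = (\<Sum>e\<in>B. v e)"
  have "P = (\<Sum>e\<in>B. 1 / (l e - b) - d * (1 / ((l e - b) * (l e - c))))"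
    unfolding P_def v_def
  proof (intro sum.cong refl)
    fix e assume "e \<in> B"
    moreover have "d = b - c" by (simp add: c_def)
    moreover have partial_fraction: "1 / t = 1 / s - (t - s) * (1 / (s * t))" if "s \<noteq> 0" "t \<noteq> 0" for s t :: real
      using that by (simp add: field_simps)
    ultimately show "1 / (l e - c) = 1 / (l e - b) - d * (1 / ((l e - b) * (l e - c)))"
      using lc[of e] partial_fraction[of "l e - b" "l e - c"] by simp
  qed
  then have P: "P = (\<Sum>e\<in>B. 1 / (l e - b)) - d * q"
    by (simp add: sum_subtractf q_def sum_distrib_left)
  have Ple: "P \<le> - (DIM('a) + 1 / d) - d * q" using P pot by simp
  have "b \<le> d * real (card {e \<in> B. l e = 0})"
  proof -
    have "d * (real DIM('a) - real k) \<le> d * real (card {e \<in> B. l e = 0})"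
      using frame_operator_kernel_card[OF B l] b by (intro mult_left_mono) auto
    then show ?thesis by (rule order_trans[OF b(3)])
  qed
  then have pq: "(\<Sum>e\<in>B. (v e)\<^sup>2) \<le> q + d\<^sup>2 * q\<^sup>2"
    using barrier_shift[of B l b d] finB lb b by (simp add: v_def q_def c_def power_divide)
  have q: "0 < q"
    unfolding q_def
  proof (rule sum_pos[OF finB])
    show "B \<noteq> {}" using orthonormal_basis_card[OF B] by force
    fix e assume "e \<in> B"
    then show "0 < 1 / ((l e - b) * (l e - c))"
      using lb[of e] c by (auto intro: mult_neg_neg mult_pos_pos)
  qed
  \<comment> \<open>Chosen so that \<open>u \<bullet> T u \<le> - (d * q)\<close> becomes
    \<open>w \<bullet> w \<le> - (d * q) * (1 + g)\<close> with \<open>w = M u\<close> and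
    \<open>g = u \<bullet> w\<close>.\<close>
  define T where "T y = M (M y) + (d * q) *\<^sub>R M y" for y
  have "linear T" unfolding T_def
    by (intro linearI) (simp_all add: M.add M.scale algebra_simps)
  then obtain u where u: "u \<in> C" "u \<bullet> T u \<le> operator_trace T / DIM('a)" using C by blast
  have "operator_trace T = (\<Sum>e\<in>B. (v e)\<^sup>2 + d * q * v e)"
    unfolding operator_trace_orthonormal_basis[OF \<open>linear T\<close> B]
  proof (intro sum.cong refl)
    fix e assume e: "e \<in> B"
    show "e \<bullet> T e = (v e)\<^sup>2 + d * q * v e"
      using unitB[OF e] unfolding norm_eq_1
      by (simp add: T_def M(3)[OF e] M.scale inner_simps power2_eq_square)
  qed
  also have "\<dots> = (\<Sum>e\<in>B. (v e)\<^sup>2) + d * q * P"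
    by (simp add: sum.distrib P_def sum_distrib_left)
  \<comment> \<open>The \<open>1 / d\<close> in the potential cancels \<open>q\<close>, the drop
    \<open>d * q\<close> cancels \<open>d\<^sup>2 * q\<^sup>2\<close>, and \<open>- (d * q)\<close>
    per dimension remains.\<close>
  also have "\<dots> \<le> q + d\<^sup>2 * q\<^sup>2 + d * q * (- (DIM('a) + 1 / d) - d * q)"
    using pq Ple q b by (intro add_mono mult_left_mono) auto
  also have "\<dots> = - (d * q) * DIM('a)"
    using b by (simp add: power2_eq_square field_simps)
  finally have "operator_trace T / DIM('a) \<le> - (d * q)"
    by (simp add: divide_le_eq)
  define w where "w = M u"
  define g where "g = u \<bullet> w"
  have "u \<bullet> T u = w \<bullet> w + d * q * g"
    using M(2)[of u w] by (simp add: T_def inner_simps w_def g_def)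
  then have w: "w \<bullet> w \<le> - (d * q) * (1 + g)"
    using u(2) \<open>operator_trace T / DIM('a) \<le> - (d * q)\<close> by (simp add: algebra_simps)
  \<comment> \<open>\<open>w\<close> is mapped to the unit vector \<open>u\<close> by a linear map,
    hence is nonzero; this makes \<open>1 + g < 0\<close> strict.\<close>
  have "w \<noteq> 0" using AM[of u] unit[OF u(1)] A.zero by (auto simp: w_def)
  then have "0 < w \<bullet> w" by simp
  then have "0 < - (d * q) * (1 + g)" using w by linarith
  then have "(d * q) * (1 + g) < (d * q) * 0" by simp
  moreover have "0 < d * q" using q b by simp
  ultimately have neg: "1 + g < 0" by (simp only: mult_less_cancel_left_pos)
  have rb': "riesz_bound c (x(k := u)) (Suc k)"
    using riesz_bound_extend[OF rb c(1,2) AM[of u]] neg by (simp add: w_def g_def)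
  let ?A = "frame_operator (x(k := u)) (Suc k)"
  have A': "?A y = frame_operator x k y + (u \<bullet> y) *\<^sub>R u" for y
    by (simp add: frame_operator_def)
  obtain B' l' where B': "orthonormal_basis B'" and l': "\<And>e. e \<in> B' \<Longrightarrow> ?A e = l' e *\<^sub>R e"
    using selfadjoint_orthonormal_eigenbasis[OF linear_frame_operator frame_operator_selfadjoint]
    by blast
  text \<open>The Sherman--Morrison formula for the inverse of \<open>?A - c\<close>.\<close>
  define N where "N y = M y - ((w \<bullet> y) / (1 + g)) *\<^sub>R w" for y
  have linN: "linear N" unfolding N_def
    by (intro linearI) (simp_all add: M.add M.scale inner_simps add_divide_distrib algebra_simps)
  have AN: "?A (N y) - c *\<^sub>R N y = y" for y
  proof -
    have uM: "u \<bullet> M y = w \<bullet> y" using M(2)[of u y] by (simp add: w_def)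
    define t where "t = (w \<bullet> y) / (1 + g)"
    have t: "t * (1 + g) = w \<bullet> y" using neg by (simp add: t_def)
    have "?A (N y) - c *\<^sub>R N y = (frame_operator x k (M y) - c *\<^sub>R M y)
        - t *\<^sub>R (frame_operator x k w - c *\<^sub>R w) + (w \<bullet> y - t * g) *\<^sub>R u"
      unfolding A' N_def t_def[symmetric]
      by (simp add: A.diff A.scale inner_simps uM g_def[symmetric] algebra_simps)
    also have "\<dots> = y + (w \<bullet> y - t * (1 + g)) *\<^sub>R u"
      by (simp add: AM w_def algebra_simps)
    finally show ?thesis by (simp add: t)
  qed
  \<comment> \<open>The new potential is a trace, so it can be evaluated in the old eigenbasis
    \<open>B\<close>, where \<open>M\<close> is diagonal.\<close>
  have "(\<Sum>e\<in>B'. 1 / (l' e - c)) = operator_trace N"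
    unfolding operator_trace_orthonormal_basis[OF linN B']
  proof (intro sum.cong refl)
    fix e assume e: "e \<in> B'"
    have "(l' e - c) * (e \<bullet> N e) = (?A e) \<bullet> N e - c * (e \<bullet> N e)"
      by (simp add: l'[OF e] algebra_simps)
    also have "\<dots> = e \<bullet> (?A (N e) - c *\<^sub>R N e)"
      unfolding frame_operator_selfadjoint by (simp add: inner_simps)
    also have "\<dots> = 1" using B' e by (simp add: AN orthonormal_basis_def norm_eq_1)
    finally have "(l' e - c) * (e \<bullet> N e) = 1" .
    then show "1 / (l' e - c) = e \<bullet> N e"
      by (metis inverse_unique inverse_eq_divide)
  qed
  also have "\<dots> = (\<Sum>e\<in>B. v e - ((w \<bullet> e) * (w \<bullet> e)) / (1 + g))"
    unfolding operator_trace_orthonormal_basis[OF linN B]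
  proof (intro sum.cong refl)
    fix e assume e: "e \<in> B"
    show "e \<bullet> N e = v e - ((w \<bullet> e) * (w \<bullet> e)) / (1 + g)"
      using unitB[OF e] unfolding norm_eq_1
      by (simp add: N_def M(3)[OF e] inner_simps inner_commute)
  qed
  also have "\<dots> = P - (w \<bullet> w) / (1 + g)"
    by (simp add: sum_subtractf P_def sum_divide_distrib[symmetric] orthonormal_basis_inner[OF B])
  also have "\<dots> \<le> P + d * q"
    using w neg by (simp add: field_simps)
  also have "\<dots> \<le> - (DIM('a) + 1 / d)" using Ple by simp
  finally have "(\<Sum>e\<in>B'. 1 / (l' e - c)) \<le> - (DIM('a) + 1 / d)" .
  then have "barrier_state (DIM('a) + 1 / d) c (x(k := u)) (Suc k)"
    using rb' B' l' unfolding barrier_state_def by blast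
  then show ?thesis using u(1) unfolding c_def by blast
qed

section \<open>Restricted invertibility\<close>

text \<open>Starting from the barrier \<open>1 - r\<close>, \<open>N\<close> steps of length
  \<open>d\<close> end at \<open>(1 - r)\<^sup>2\<close>, the square of the asserted
  constant.\<close>

theorem restricted_invertibility:
  fixes C :: "'a::euclidean_space set"
  assumes C: "\<And>T. linear T \<Longrightarrow> \<exists>u\<in>C. u \<bullet> T u \<le> operator_trace T / DIM('a)"
    and unit: "\<And>u. u \<in> C \<Longrightarrow> norm u = 1"
    and N: "N < DIM('a)"
  obtains x :: "nat \<Rightarrow> 'a" where "\<And>j. j < N \<Longrightarrow> x j \<in> C"
    and "\<And>a. (1 - sqrt (N / DIM('a))) * sqrt (\<Sum>j<N. (a j)\<^sup>2) \<le> norm (\<Sum>j<N. a j *\<^sub>R x j)"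
proof (cases "N = 0")
  case True
  then show thesis by (intro that[of undefined]) auto
next
  case False
  define n where "n = real DIM('a)"
  define r where "r = sqrt (N / n)"
  have n: "n > 0" by (simp add: n_def)
  have r: "0 < r" "r < 1" and r2: "real N = r\<^sup>2 * n"
    using False N n by (auto simp: r_def n_def real_sqrt_lt_1_iff)
  \<comment> \<open>With this step length \<open>n + 1 / d\<close> equals
    \<open>n / (1 - r)\<close>, so the empty system meets the potential bound with equality.\<close>
  define d where "d = (1 - r) / (r * n)"
  have d: "d > 0" "d * n = (1 - r) / r" using r n by (auto simp: d_def)
  have h: "n + 1 / d = n / (1 - r)" using r n by (simp add: d_def field_simps)
  have final: "1 - r - real N * d = (1 - r)\<^sup>2"
  proof -
    have "real N * d = r\<^sup>2 * (d * n)" using r2 by simp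
    also have "\<dots> = r * (1 - r)" using r d(2) by (simp add: power2_eq_square)
    finally show ?thesis by (simp add: power2_eq_square algebra_simps)
  qed
  have "\<exists>x. (\<forall>j<k. x j \<in> C) \<and> barrier_state (n + 1 / d) (1 - r - real k * d) x k" if "k \<le> N" for k
    using that
  proof (induction k)
    case 0
    have "barrier_state (n + 1 / d) (1 - r) x 0" for x :: "nat \<Rightarrow> 'a"
      unfolding barrier_state_def h
    proof (intro conjI exI[of _ Basis] exI[of _ "\<lambda>_. 0"])
      show "(\<Sum>e\<in>(Basis::'a set). 1 / (0 - (1 - r))) \<le> - (n / (1 - r))"
        by (simp add: n_def minus_divide_right[symmetric])
           (metis minus_diff_eq minus_divide_right order_refl)
    qed (auto simp: riesz_bound_def orthonormal_basis_Basis frame_operator_def)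
    then show ?case by auto
  next
    case (Suc k)
    then obtain x where x: "\<forall>j<k. x j \<in> C" "barrier_state (n + 1 / d) (1 - r - real k * d) x k"
      by auto
    have "real (Suc k) * d \<le> real N * d" using Suc.prems d by (intro mult_right_mono) auto
    then have "real k * d + d \<le> real N * d" by (simp add: algebra_simps)
    moreover have "0 < (1 - r)\<^sup>2" using r by simp
    ultimately have pos: "0 < 1 - r - real k * d - d" using final by linarith
    \<comment> \<open>The condition on \<open>b\<close> in \<open>barrier_step\<close> reduces to
      \<open>1 - r \<le> d * n\<close>.\<close>
    have "(1 - r) * 1 \<le> (1 - r) * (1 / r)" using r by (intro mult_left_mono) auto
    then have "1 - r \<le> (1 - r) / r" by simp
    then have le: "1 - r - real k * d \<le> d * (n - real k)" using d(2) by (simp add: algebra_simps)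
    obtain u where "u \<in> C" "barrier_state (n + 1 / d) (1 - r - real k * d - d) (x(k := u)) (Suc k)"
      using barrier_step[OF C unit x(2)[unfolded n_def] pos d(1) le[unfolded n_def]]
      unfolding n_def by blast
    moreover have "1 - r - real k * d - d = 1 - r - real (Suc k) * d" by (simp add: algebra_simps)
    moreover have "\<forall>j<Suc k. (x(k := u)) j \<in> C" if "u \<in> C" for u
      using x(1) that by (auto simp: less_Suc_eq)
    ultimately show ?case by metis
  qed
  from this[of N] obtain x where x: "\<And>j. j < N \<Longrightarrow> x j \<in> C" "riesz_bound ((1 - r)\<^sup>2) x N"
    using final unfolding barrier_state_def by auto
  have "(1 - r) * sqrt (\<Sum>j<N. (a j)\<^sup>2) \<le> norm (\<Sum>j<N. a j *\<^sub>R x j)" for a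
    using real_sqrt_le_mono[OF riesz_bound_le[OF x(2), of a]] r by (simp add: real_sqrt_mult)
  then show thesis using x(1) unfolding r_def n_def by (intro that[of x])
qed

section \<open>Selection of well-conditioned vectors, up to full dimension\<close>

lemma one_minus_sqrt_ge:
  assumes "t \<le> (1::real)" shows "t / 2 \<le> 1 - sqrt (1 - t)"
proof -
  have "sqrt (1 - t) \<le> sqrt ((1 - t / 2)\<^sup>2)"
    by (intro real_sqrt_le_mono) (simp add: power2_eq_square algebra_simps)
  then show ?thesis using assms by simp
qed

text \<open>Serves the case where \<open>Suc N\<close> is the dimension \<open>n\<close> and the
  barrier bound would vanish. A new vector with component at least \<open>1 / sqrt n\<close> along a
  unit normal \<open>e\<close> of the old ones has its coefficient controlled by that component, up
  to the factor \<open>sqrt n\<close>.\<close>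

lemma extend_by_almost_orthogonal:
  fixes C :: "'a::euclidean_space set"
  assumes C: "\<And>T. linear T \<Longrightarrow> \<exists>u\<in>C. u \<bullet> T u \<le> operator_trace T / DIM('a)"
    and unit: "\<And>u. u \<in> C \<Longrightarrow> norm u = 1"
    and N: "N < DIM('a)" and s: "0 < s" "s \<le> 1"
    and x: "\<And>a. s * sqrt (\<Sum>j<N. (a j)\<^sup>2) \<le> norm (\<Sum>j<N. a j *\<^sub>R x j)"
  obtains u where "u \<in> C"
    "\<And>a. s * sqrt (\<Sum>j<Suc N. (a j)\<^sup>2) \<le> (1 + 2 * sqrt DIM('a)) * norm (\<Sum>j<Suc N. a j *\<^sub>R (x(N := u)) j)"
proof -
  define n where "n = real DIM('a)"
  have n: "n > 0" by (simp add: n_def)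
  have "dim (x ` {..<N}) \<le> card (x ` {..<N})" by (intro dim_le_card') auto
  also have "\<dots> \<le> N" using card_image_le[of "{..<N}" x] by simp
  finally have "dim (x ` {..<N}) < DIM('a)" using N by simp
  then obtain e0 where e0: "e0 \<noteq> 0" "\<And>y. y \<in> span (x ` {..<N}) \<Longrightarrow> orthogonal e0 y"
    using orthogonal_to_subspace_exists by blast
  define e where "e = e0 /\<^sub>R norm e0"
  have ex: "e \<bullet> x j = 0" if "j < N" for j
    using e0(2)[of "x j"] that by (auto simp: e_def orthogonal_def span_base)
  have e: "norm e = 1" using e0 by (simp add: e_def)
  \<comment> \<open>Minus the projection onto the line of \<open>e\<close>: its trace is -1, so the
    hypothesis on \<open>C\<close> gives \<open>(e \<bullet> u)\<^sup>2 \<ge> 1 / n\<close>.\<close>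
  define T where "T y = - (e \<bullet> y) *\<^sub>R e" for y
  have "linear T" unfolding T_def by (intro linearI) (simp_all add: inner_simps algebra_simps)
  moreover have "operator_trace T = - (e \<bullet> e)"
    unfolding operator_trace_def T_def
    by (subst euclidean_inner[of e e]) (simp add: sum_negf inner_commute)
  ultimately obtain u where u: "u \<in> C" "u \<bullet> T u \<le> - (1 / n)"
    using C[of T] e norm_eq_1[of e] by (auto simp: n_def)
  have "1 / n \<le> (e \<bullet> u)\<^sup>2"
    using u(2) by (simp add: T_def inner_commute power2_eq_square)
  then have eu: "1 \<le> sqrt n * \<bar>e \<bullet> u\<bar>"
    using n real_sqrt_le_mono[of "1 / n" "(e \<bullet> u)\<^sup>2"] by (simp add: real_sqrt_divide field_simps)
  show thesis
  proof (rule that[of u, OF u(1)])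
    fix a :: "nat \<Rightarrow> real"
    define t where "t = a N"
    define y where "y = (\<Sum>j<N. a j *\<^sub>R x j)"
    define v where "v = y + t *\<^sub>R u"
    have "e \<bullet> y = 0" by (simp add: y_def inner_sum_right ex)
    then have "\<bar>t\<bar> * \<bar>e \<bullet> u\<bar> \<le> norm v"
      using Cauchy_Schwarz_ineq2[of e v] e by (simp add: v_def inner_simps abs_mult)
    then have "sqrt n * (\<bar>t\<bar> * \<bar>e \<bullet> u\<bar>) \<le> sqrt n * norm v" using n by (intro mult_left_mono) auto
    moreover have "\<bar>t\<bar> * 1 \<le> \<bar>t\<bar> * (sqrt n * \<bar>e \<bullet> u\<bar>)" using eu by (intro mult_left_mono) auto
    ultimately have t: "\<bar>t\<bar> \<le> sqrt n * norm v" by (simp add: algebra_simps)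
    have "norm y \<le> norm v + \<bar>t\<bar>"
      using norm_triangle_ineq4[of v "t *\<^sub>R u"] unit[OF u(1)] by (simp add: v_def)
    then have "s * sqrt (\<Sum>j<N. (a j)\<^sup>2) \<le> norm v + \<bar>t\<bar>" using x[of a] by (simp add: y_def)
    moreover have "s * \<bar>t\<bar> \<le> \<bar>t\<bar>" using s by (simp add: mult_left_le_one_le)
    moreover have "sqrt (\<Sum>j<Suc N. (a j)\<^sup>2) \<le> sqrt (\<Sum>j<N. (a j)\<^sup>2) + \<bar>t\<bar>"
      using sqrt_add_le_add_sqrt[of "\<Sum>j<N. (a j)\<^sup>2" "t\<^sup>2"] by (simp add: t_def sum_nonneg)
    then have "s * sqrt (\<Sum>j<Suc N. (a j)\<^sup>2) \<le> s * (sqrt (\<Sum>j<N. (a j)\<^sup>2) + \<bar>t\<bar>)"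
      using s by (intro mult_left_mono) auto
    ultimately have "s * sqrt (\<Sum>j<Suc N. (a j)\<^sup>2) \<le> (1 + 2 * sqrt n) * norm v"
      using t by (simp add: algebra_simps)
    then show "s * sqrt (\<Sum>j<Suc N. (a j)\<^sup>2)
        \<le> (1 + 2 * sqrt DIM('a)) * norm (\<Sum>j<Suc N. a j *\<^sub>R (x(N := u)) j)"
      by (simp add: v_def y_def t_def n_def)
  qed
qed

text \<open>The selection leaves \<open>m div 2\<close> dimensions free, a proportion of at least
  \<open>\<epsilon> / 3\<close> if \<open>m \<ge> 2\<close>. For \<open>m = 1\<close> none is free,
  but then \<open>\<epsilon> \<le> 1 / n\<close> and a bound of order
  \<open>1 / (n * sqrt n)\<close> suffices.\<close>

lemma well_conditioned_selection:
  fixes C :: "'a::euclidean_space set" and \<epsilon> :: real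
  assumes C: "\<And>T. linear T \<Longrightarrow> \<exists>u\<in>C. u \<bullet> T u \<le> operator_trace T / DIM('a)"
    and unit: "\<And>u. u \<in> C \<Longrightarrow> norm u = 1"
    and \<epsilon>: "0 < \<epsilon>" "\<epsilon> < 1" "\<epsilon> * DIM('a) \<le> m"
    and m: "L + m = DIM('a)"
  obtains x :: "nat \<Rightarrow> 'a" where "\<And>j. j < L + (m + 1) div 2 \<Longrightarrow> x j \<in> C"
    and "\<And>a. \<epsilon> * sqrt \<epsilon> / 8 * sqrt (\<Sum>j<L + (m + 1) div 2. (a j)\<^sup>2)
            \<le> norm (\<Sum>j<L + (m + 1) div 2. a j *\<^sub>R x j)"
proof -
  define n where "n = real DIM('a)"
  have n: "n \<ge> 1" unfolding n_def by (simp add: Suc_leI)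
  have "0 < \<epsilon> * DIM('a)" using \<epsilon> by simp
  then have "real m \<noteq> 0" using \<epsilon> by linarith
  then consider "m = 1" | "m \<ge> 2" by fastforce
  then show thesis
  proof cases
    case 1
    have LN: "L < DIM('a)" "L = n - 1" using m 1 by (auto simp: n_def)
    obtain x where x: "\<And>j. j < L \<Longrightarrow> x j \<in> C"
      "\<And>a. (1 - sqrt (L / DIM('a))) * sqrt (\<Sum>j<L. (a j)\<^sup>2) \<le> norm (\<Sum>j<L. a j *\<^sub>R x j)"
      using restricted_invertibility[OF C unit LN(1)] by blast
    have "real L / n = 1 - 1 / n" using LN n by (simp add: field_simps)
    then have s: "1 / (2 * n) \<le> 1 - sqrt (L / DIM('a))"
      using one_minus_sqrt_ge[of "1 / n"] n by (simp add: n_def)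
    have x': "1 / (2 * n) * sqrt (\<Sum>j<L. (a j)\<^sup>2) \<le> norm (\<Sum>j<L. a j *\<^sub>R x j)" for a
      by (rule order_trans[OF mult_right_mono[OF s] x(2)]) (simp add: sum_nonneg)
    obtain u where u: "u \<in> C"
      "\<And>a. 1 / (2 * n) * sqrt (\<Sum>j<Suc L. (a j)\<^sup>2) \<le> (1 + 2 * sqrt DIM('a)) * norm (\<Sum>j<Suc L. a j *\<^sub>R (x(L := u)) j)"
      using extend_by_almost_orthogonal[OF C unit LN(1) _ _ x'] n by auto
    have N: "L + (m + 1) div 2 = Suc L" using 1 by simp
    have sn: "sqrt n \<ge> 1" using n by simp
    have "\<epsilon> \<le> 1 / n" using \<epsilon> 1 n by (simp add: n_def field_simps)
    then have "\<epsilon> * sqrt \<epsilon> \<le> 1 / n * sqrt (1 / n)"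
      using \<epsilon> n by (intro mult_mono real_sqrt_le_mono) auto
    then have e: "\<epsilon> * sqrt \<epsilon> * (n * sqrt n) \<le> 1"
      using n by (simp add: real_sqrt_divide field_simps)
    show thesis
    proof (rule that[of "x(L := u)"])
      show "(x(L := u)) j \<in> C" if "j < L + (m + 1) div 2" for j
        using that[unfolded N] x(1) u(1) by (auto simp: less_Suc_eq)
      fix a :: "nat \<Rightarrow> real"
      define S where "S = sqrt (\<Sum>j<Suc L. (a j)\<^sup>2)"
      define v where "v = norm (\<Sum>j<Suc L. a j *\<^sub>R (x(L := u)) j)"
      have "S \<le> 2 * n * ((1 + 2 * sqrt n) * v)"
        using u(2)[of a] n by (simp add: S_def v_def n_def field_simps)
      \<comment> \<open>The total loss is \<open>6 * n * sqrt n\<close>, which the denominator 8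
        absorbs.\<close>
      also have "\<dots> \<le> 2 * n * ((3 * sqrt n) * v)"
        using n sn by (intro mult_left_mono mult_right_mono) (auto simp: v_def)
      finally have "\<epsilon> * sqrt \<epsilon> / 8 * S \<le> \<epsilon> * sqrt \<epsilon> / 8 * (2 * n * ((3 * sqrt n) * v))"
        using \<epsilon> by (intro mult_left_mono) auto
      also have "\<dots> = 3 / 4 * (\<epsilon> * sqrt \<epsilon> * (n * sqrt n)) * v" by simp
      also have "\<dots> \<le> 1 * v"
        using e by (intro mult_right_mono) (auto simp: v_def)
      finally show "\<epsilon> * sqrt \<epsilon> / 8 * sqrt (\<Sum>j<L + (m + 1) div 2. (a j)\<^sup>2)
            \<le> norm (\<Sum>j<L + (m + 1) div 2. a j *\<^sub>R (x(L := u)) j)"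
        unfolding N S_def v_def by simp
    qed
  next
    case 2
    define N where "N = L + (m + 1) div 2"
    have "(m + 1) div 2 + m div 2 = m" by presburger
    then have Nm: "N + m div 2 = DIM('a)" using m unfolding N_def by linarith
    then have "N < DIM('a)" using 2 by linarith
    then obtain x where x: "\<And>j. j < N \<Longrightarrow> x j \<in> C"
      "\<And>a. (1 - sqrt (N / DIM('a))) * sqrt (\<Sum>j<N. (a j)\<^sup>2) \<le> norm (\<Sum>j<N. a j *\<^sub>R x j)"
      using restricted_invertibility[OF C unit] by blast
    define t where "t = real (m div 2) / n"
    have "real N + real (m div 2) = n" using Nm unfolding n_def by (metis of_nat_add)
    then have Nt: "real N / n = 1 - t" using n by (simp add: t_def field_simps)
    moreover have "0 \<le> real N / n" using n by simp
    ultimately have "t \<le> 1" by linarith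
    \<comment> \<open>Equality holds at \<open>m = 3\<close>. The resulting constant
      \<open>\<epsilon> / 6\<close> dominates
      \<open>\<epsilon> * sqrt \<epsilon> / 8\<close>.\<close>
    have "m \<le> 3 * (m div 2)" using 2 by presburger
    then have "real m \<le> 3 * real (m div 2)" by linarith
    then have "\<epsilon> * n \<le> 3 * real (m div 2)" using \<epsilon>(3) by (simp add: n_def)
    then have "\<epsilon> / 3 \<le> t" using n by (simp add: t_def field_simps)
    moreover have "\<epsilon> * sqrt \<epsilon> \<le> \<epsilon>" using \<epsilon> mult_left_mono[of "sqrt \<epsilon>" 1 \<epsilon>] by simp
    ultimately have "\<epsilon> * sqrt \<epsilon> / 8 \<le> 1 - sqrt (1 - t)"
      using one_minus_sqrt_ge[OF \<open>t \<le> 1\<close>] \<epsilon>(1) by linarith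
    then have s: "\<epsilon> * sqrt \<epsilon> / 8 \<le> 1 - sqrt (N / DIM('a))"
      unfolding Nt[symmetric] n_def .
    show thesis
    proof (rule that[of x, folded N_def])
      show "x j \<in> C" if "j < N" for j using that by (rule x(1))
      show "\<epsilon> * sqrt \<epsilon> / 8 * sqrt (\<Sum>j<N. (a j)\<^sup>2) \<le> norm (\<Sum>j<N. a j *\<^sub>R x j)" for a
        by (rule order_trans[OF mult_right_mono[OF s] x(2)]) (simp add: sum_nonneg)
    qed
  qed
qed

section \<open>The dual form of John's theorem\<close>

lemma operator_trace_eq_trace:
  fixes T :: "real ^ 'n \<Rightarrow> real ^ 'n"
  shows "operator_trace T = trace (matrix T)"
proof -
  have B: "(Basis :: (real ^ 'n) set) = range (\<lambda>i. axis i 1)"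
    by (auto simp: Basis_vec_def)
  have "inj (\<lambda>i::'n. axis i (1::real))" by (auto simp: inj_def axis_eq_axis)
  then show ?thesis
    unfolding operator_trace_def B trace_def matrix_def
    by (simp add: sum.reindex inner_axis' )
qed

section \<open>Determinants and volumes under linear maps\<close>

lemma det_derivative_at_one:
  fixes H :: "real ^ 'n ^ 'n"
  shows "((\<lambda>t. det (mat 1 + t *\<^sub>R H)) has_real_derivative trace H) (at 0)"
proof -
  let ?a = "\<lambda>p i t. (mat 1 + t *\<^sub>R H) $ i $ p i"
  let ?d = "\<lambda>p. \<Sum>i\<in>UNIV. H $ i $ p i * (\<Prod>j\<in>UNIV - {i}. (mat 1 :: real ^ 'n ^ 'n) $ j $ p j)"
  have "((\<lambda>t. ?a p i t) has_real_derivative H $ i $ p i) (at 0)" for p :: "'n \<Rightarrow> 'n" and i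
    by (auto intro!: derivative_eq_intros)
  then have *: "((\<lambda>t. \<Prod>i\<in>UNIV. ?a p i t) has_real_derivative ?d p) (at 0)" for p
    using has_field_derivative_prod[of UNIV "?a p" "\<lambda>i. H $ i $ p i" 0] by simp
  have "((\<lambda>t. det (mat 1 + t *\<^sub>R H)) has_real_derivative
      (\<Sum>p | p permutes UNIV. of_int (sign p) * ?d p)) (at 0)"
    unfolding det_def by (intro DERIV_sum DERIV_cmult *)
  moreover have "(\<Sum>p | p permutes (UNIV::'n set). of_int (sign p) * ?d p) = trace H"
  proof -
    \<comment> \<open>A permutation other than the identity moves at least two indices, so deleting
      one factor still leaves an off-diagonal zero of the identity matrix.\<close>
    have zero: "?d p = 0" if p: "p permutes UNIV" "p \<noteq> id" for p
    proof (intro sum.neutral ballI)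
      fix i
      have "\<exists>j. j \<noteq> i \<and> p j \<noteq> j"
      proof (rule ccontr)
        assume "\<not> ?thesis"
        then have fixed: "p j = j" if "j \<noteq> i" for j using that by blast
        then have "p i = i" using permutes_inj[OF p(1)] by (metis injD)
        with fixed p(2) show False by (metis eq_id_iff)
      qed
      then obtain j where j: "j \<in> UNIV - {i}" "p j \<noteq> j" by blast
      then have "(\<Prod>j\<in>UNIV - {i}. (mat 1 :: real ^ 'n ^ 'n) $ j $ p j) = 0"
        by (intro prod_zero bexI[OF _ j(1)]) (auto simp: mat_def)
      then show "H $ i $ p i * (\<Prod>j\<in>UNIV - {i}. (mat 1 :: real ^ 'n ^ 'n) $ j $ p j) = 0" by simp
    qed
    have "(\<Sum>p | p permutes (UNIV::'n set). of_int (sign p) * ?d p)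
        = (\<Sum>p\<in>{id}. of_int (sign p) * ?d p)"
      by (rule sum.mono_neutral_right) (auto simp: zero permutes_id)
    then show ?thesis by (simp add: mat_def trace_def)
  qed
  ultimately show ?thesis by simp
qed

text \<open>The library proves \<open>measure_linear_image\<close> only for an index type of class \<open>wellorder\<close>.\<close>

definition scales_volume :: "(real ^ 'n \<Rightarrow> real ^ 'n) \<Rightarrow> bool" where
  "scales_volume f \<longleftrightarrow> (\<forall>S\<in>lmeasurable. f ` S \<in> lmeasurable \<and>
     measure lebesgue (f ` S) = \<bar>det (matrix f)\<bar> * measure lebesgue S)"

text \<open>Translation moves any box to one with corner 0, and boxes determine the measure of all
  linear images. It is used for coordinate swaps and shears.\<close>

lemma scales_volume_cbox:
  fixes f :: "real ^ 'n \<Rightarrow> real ^ 'n"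
  assumes f: "linear f" and det: "\<bar>det (matrix f)\<bar> = 1"
    and box: "\<And>b. cbox 0 b \<noteq> {} \<Longrightarrow> measure lebesgue (f ` cbox 0 b) = measure lebesgue (cbox 0 b)"
  shows "scales_volume f"
proof -
  have "measure lebesgue (f ` cbox a b) = 1 * measure lebesgue (cbox a b)" for a b
  proof (cases "cbox a b = {}")
    case False
    have ab: "cbox a b = (+) a ` cbox 0 (b - a)" using cbox_translation[of a 0 "b - a"] by simp
    then have "f ` cbox a b = (+) (f a) ` f ` cbox 0 (b - a)"
      by (simp add: image_image linear_add[OF f])
    then have "measure lebesgue (f ` cbox a b) = measure lebesgue (f ` cbox 0 (b - a))"
      by (simp only: measure_translation)
    also have "\<dots> = measure lebesgue (cbox 0 (b - a))" using False ab by (intro box) auto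
    also have "\<dots> = measure lebesgue (cbox a b)" unfolding ab by (simp only: measure_translation)
    finally show ?thesis by simp
  qed simp
  then have "f ` S \<in> lmeasurable \<and> 1 * measure lebesgue S = measure lebesgue (f ` S)"
    if "S \<in> lmeasurable" for S
    by (rule measure_linear_sufficient[OF f that])
  then show ?thesis unfolding scales_volume_def det by metis
qed

text \<open>Induction over elementary maps: the factor is multiplicative under composition, zero if
  a coordinate vanishes identically, a product for stretches, and 1 for swaps and shears.\<close>

lemma scales_volume_linear:
  fixes f :: "real ^ 'n \<Rightarrow> real ^ 'n"
  assumes "linear f" shows "scales_volume f"
  using assms
proof (rule induct_linear_elementary)
  fix f g :: "real ^ 'n \<Rightarrow> real ^ 'n"
  assume lin: "linear f" "linear g" and f: "scales_volume f" and g: "scales_volume g"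
  show "scales_volume (f \<circ> g)"
    unfolding scales_volume_def image_comp[symmetric] matrix_compose[OF lin(2,1)]
    using f g by (auto simp: scales_volume_def det_mul abs_mult)
next
  fix f :: "real ^ 'n \<Rightarrow> real ^ 'n" and i
  assume f: "linear f" and z: "\<And>x. f x $ i = 0"
  have "row i (matrix f) = 0" by (simp add: row_def matrix_def z vec_eq_iff)
  then have "det (matrix f) = 0" by (rule det_zero_row)
  moreover have "negligible (f ` S)" for S
    by (rule negligible_subset[OF negligible_standard_hyperplane_cart[of i]]) (auto simp: z)
  ultimately show "scales_volume f"
    unfolding scales_volume_def by (metis abs_0 mult_zero_left negligible_iff_measure)
next
  fix c :: "'n \<Rightarrow> real"
  have "det (matrix (\<lambda>x::real ^ 'n. \<chi> i. c i * x $ i)) = prod c UNIV"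
    by (subst det_diagonal) (auto simp: matrix_def axis_def)
  then show "scales_volume (\<lambda>x::real ^ 'n. \<chi> i. c i * x $ i)"
    unfolding scales_volume_def by (simp add: measurable_stretch measure_stretch)
next
  fix m n :: 'n
  let ?\<tau> = "Transposition.transpose m n"
  let ?f = "\<lambda>x::real ^ 'n. \<chi> i. x $ ?\<tau> i"
  have \<tau>: "?\<tau> permutes UNIV" by (rule permutes_swap_id) auto
  show "scales_volume ?f"
  proof (rule scales_volume_cbox)
    show "linear ?f" by (intro linearI) (auto simp: vec_eq_iff)
    have "matrix ?f = (\<chi> i j. (mat 1 :: real ^ 'n ^ 'n) $ i $ ?\<tau> j)"
      unfolding vec_eq_iff
    proof (intro allI)
      fix i j
      have "?\<tau> i = j \<longleftrightarrow> i = ?\<tau> j" by (metis transpose_involutory)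
      then show "matrix ?f $ i $ j = (\<chi> i j. (mat 1 :: real ^ 'n ^ 'n) $ i $ ?\<tau> j) $ i $ j"
        by (simp add: matrix_def mat_def axis_def)
    qed
    then show "\<bar>det (matrix ?f)\<bar> = 1"
      by (simp add: det_permute_columns[OF \<tau>] sign_def)
    fix b :: "real ^ 'n"
    assume ne: "cbox 0 b \<noteq> {}"
    have "?f ` cbox 0 b = cbox 0 (?f b)"
    proof
      show "cbox 0 (?f b) \<subseteq> ?f ` cbox 0 b"
      proof
        fix x assume x: "x \<in> cbox 0 (?f b)"
        have "?f x \<in> cbox 0 b"
          using x unfolding mem_box_cart by (metis transpose_involutory vec_lambda_beta zero_index)
        moreover have "x = ?f (?f x)" by (simp add: vec_eq_iff)
        ultimately show "x \<in> ?f ` cbox 0 b" by blast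
      qed
    qed (auto simp: mem_box_cart)
    moreover have "prod (($) (?f b)) UNIV = prod (($) b) UNIV"
      using prod.permute[OF \<tau>, of "($) b"] by (simp add: o_def)
    ultimately show "measure lebesgue (?f ` cbox 0 b) = measure lebesgue (cbox 0 b)"
      using ne content_cbox_cart[of 0 b] content_cbox_cart[of 0 "?f b"] by auto
  qed
next
  fix m n :: 'n assume mn: "m \<noteq> n"
  let ?f = "\<lambda>x::real ^ 'n. \<chi> i. if i = m then x $ m + x $ n else x $ i"
  show "scales_volume ?f"
  proof (rule scales_volume_cbox)
    show "linear ?f" by (intro linearI) (auto simp: vec_eq_iff algebra_simps)
    let ?I = "mat 1 :: real ^ 'n ^ 'n"
    have "matrix ?f = (\<chi> k. if k = m then row m ?I + 1 *s row n ?I else row k ?I)"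
      by (auto simp: matrix_def row_def mat_def axis_def vec_eq_iff)
    then have "det (matrix ?f) = det ?I" by (simp only: det_row_operation[OF mn])
    then show "\<bar>det (matrix ?f)\<bar> = 1" by simp
    show "measure lebesgue (?f ` cbox 0 b) = measure lebesgue (cbox 0 b)" if "cbox 0 b \<noteq> {}" for b
      using measure_shear_interval[OF mn that] by simp
  qed
qed

section \<open>Perturbation of the minimal ellipsoid\<close>

lemma compact_pos_lower_bound:
  fixes f :: "'a::topological_space \<Rightarrow> real"
  assumes "compact S" "continuous_on S f" "\<And>x. x \<in> S \<Longrightarrow> 0 < f x"
  obtains d where "0 < d" "\<And>x. x \<in> S \<Longrightarrow> d \<le> f x"
proof (cases "S = {}")
  case False
  then obtain x where "x \<in> S" "\<And>y. y \<in> S \<Longrightarrow> f x \<le> f y"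
    using continuous_attains_inf[OF assms(1) _ assms(2)] by blast
  then show thesis using assms(3) that by blast
qed (use that[of 1] in auto)

text \<open>The ellipsoid \<open>{x. norm (S x) \<le> r}\<close> contains \<open>K\<close>, and its
  volume is \<open>r ^ CARD('n) / \<bar>det (matrix S)\<bar>\<close> times that of the unit
  ball.\<close>

lemma min_volume_unit_ball_det:
  fixes K :: "(real ^ 'n) set"
  assumes min: "min_volume_ellipsoid (cball 0 1) K"
    and S: "linear S" and r: "0 < r" and KS: "\<And>x. x \<in> K \<Longrightarrow> norm (S x) \<le> r"
    and det: "det (matrix S) \<noteq> 0"
  shows "\<bar>det (matrix S)\<bar> \<le> r ^ CARD('n)"
proof -
  let ?R = "matrix ((*\<^sub>R) r) :: real ^ 'n ^ 'n"
  obtain A' where A': "matrix S ** A' = mat 1" "A' ** matrix S = mat 1"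
    using det unfolding invertible_det_nz[symmetric] invertible_def by blast
  \<comment> \<open>\<open>A\<close> is \<open>r\<close> times the inverse of \<open>S\<close>, so
    it maps the unit ball onto that ellipsoid.\<close>
  define A where "A = A' ** ?R"
  have "linear ((*\<^sub>R) r :: real ^ 'n \<Rightarrow> real ^ 'n)"
    by (intro linearI) (simp_all add: algebra_simps)
  then have A: "A *v y = A' *v (r *\<^sub>R y)" for y
    by (simp add: A_def matrix_works matrix_vector_mul_assoc[symmetric])
  have "det (matrix S) * det A = det (matrix S ** A' ** ?R)"
    by (simp add: A_def det_mul)
  also have "\<dots> = r ^ CARD('n)" by (simp add: A' det_mul)
  finally have "det (matrix S) * det A = r ^ CARD('n)" .
  then have detA: "\<bar>det (matrix S)\<bar> * \<bar>det A\<bar> = r ^ CARD('n)"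
    using r by (metis abs_mult abs_of_pos zero_less_power)
  then have "det A \<noteq> 0" using r by (metis abs_0 mult_zero_right power_not_zero less_irrefl)
  then have "ellipsoid ((\<lambda>x. 0 + A *v x) ` cball 0 1)"
    unfolding ellipsoid_def using invertible_det_nz by blast
  moreover have "K \<subseteq> (\<lambda>x. 0 + A *v x) ` cball 0 1"
  proof
    fix x assume x: "x \<in> K"
    have "A *v ((1 / r) *\<^sub>R S x) = A' *v (matrix S *v x)"
      using r by (simp add: A matrix_works[OF S[unfolded linear_matrix_vector_mul_eq[symmetric]]])
    also have "\<dots> = x" by (simp add: matrix_vector_mul_assoc A')
    finally have "x = A *v ((1 / r) *\<^sub>R S x)" by simp
    moreover have "(1 / r) *\<^sub>R S x \<in> cball 0 1" using KS[OF x] r by simp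
    ultimately show "x \<in> (\<lambda>x. 0 + A *v x) ` cball 0 1" by auto
  qed
  ultimately have "measure lebesgue (cball 0 1 :: (real ^ 'n) set)
      \<le> measure lebesgue ((\<lambda>x. A *v x) ` cball 0 1)"
    using min unfolding min_volume_ellipsoid_def by auto
  also have "\<dots> = \<bar>det A\<bar> * measure lebesgue (cball 0 1 :: (real ^ 'n) set)"
    using scales_volume_linear[of "(*v) A"] unfolding scales_volume_def by simp
  finally have "1 \<le> \<bar>det A\<bar>"
    using content_cball_pos[of 1 "0 :: real ^ 'n"] by simp
  then have "\<bar>det (matrix S)\<bar> * 1 \<le> \<bar>det (matrix S)\<bar> * \<bar>det A\<bar>" by (intro mult_left_mono) auto
  then show ?thesis using detA by simp
qed

text \<open>This is the only consequence of John's theorem that is needed: if it failed for \<open>T\<close>, the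
  ellipsoids \<open>{x. norm (x - t T\<^sub>0 x) \<le> sqrt (1 - t d)}\<close>, where \<open>T\<^sub>0\<close> is the traceless part of \<open>T\<close>,
  would contain \<open>K\<close> and have volume less than the unit ball for small \<open>t > 0\<close>.\<close>

lemma john_dual:
  fixes K :: "(real ^ 'n) set" and T :: "real ^ 'n \<Rightarrow> real ^ 'n"
  assumes K: "compact K" and min: "min_volume_ellipsoid (cball 0 1) K" and T: "linear T"
  shows "\<exists>u\<in>K \<inter> sphere 0 1. u \<bullet> T u \<le> operator_trace T / CARD('n)"
proof (rule ccontr)
  assume contra: "\<not> ?thesis"
  define c where "c = operator_trace T / CARD('n)"
  define U where "U x = T x - c *\<^sub>R x" for x
  have U: "linear U" unfolding U_def
    by (intro linearI) (simp_all add: linear_add[OF T] linear_scale[OF T] algebra_simps)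
  have contU: "continuous_on S U" for S
    using U by (simp add: linear_continuous_on linear_conv_bounded_linear[symmetric])
  have "operator_trace U = operator_trace T - c * operator_trace (\<lambda>x::real ^ 'n. x)"
    by (simp add: operator_trace_def U_def inner_simps sum_subtractf sum_distrib_left)
  moreover have "operator_trace (\<lambda>x::real ^ 'n. x) = CARD('n)"
    unfolding operator_trace_eq_trace id_def[symmetric] by (simp add: matrix_id_mat_1 trace_I)
  ultimately have trU: "trace (matrix U) = 0"
    by (simp add: operator_trace_eq_trace[symmetric] c_def)
  have K1: "norm x \<le> 1" if "x \<in> K" for x
    using min that unfolding min_volume_ellipsoid_def by auto
  have pos: "0 < x \<bullet> U x" if "x \<in> K \<inter> sphere 0 1" for x
    using contra that norm_eq_1[of x] by (auto simp: U_def c_def inner_simps not_le)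
  have "compact (K \<inter> sphere 0 1)" by (intro compact_Int_closed K) simp
  moreover have "continuous_on (K \<inter> sphere 0 1) (\<lambda>x. x \<bullet> U x)"
    by (intro continuous_on_inner continuous_on_id contU)
  ultimately obtain d0 where d0: "0 < d0" "\<And>x. x \<in> K \<inter> sphere 0 1 \<Longrightarrow> d0 \<le> x \<bullet> U x"
    using compact_pos_lower_bound[of _ "\<lambda>x. x \<bullet> U x"] pos by blast
  define d where "d = d0 / 2"
  have d: "0 < d" using d0 by (simp add: d_def)
  \<comment> \<open>On \<open>D\<close> the norm is bounded away from 1, so a small perturbation is
    harmless; off \<open>D\<close> the first-order term shrinks the norm. Halving \<open>d0\<close>
    keeps \<open>D\<close> off the sphere.\<close>
  define D where "D = K \<inter> {x. x \<bullet> U x \<le> d}"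
  have "compact D" unfolding D_def
    by (intro compact_Int_closed K closed_Collect_le continuous_on_inner continuous_on_id contU
        continuous_on_const)
  moreover have "0 < 1 - (norm x)\<^sup>2" if "x \<in> D" for x
  proof -
    have "norm x \<noteq> 1" using that d0(2)[of x] d0(1) by (force simp: D_def d_def)
    then have "norm x < 1" using that K1[of x] by (auto simp: D_def)
    then show ?thesis by (simp add: power_less_one_iff abs_square_less_1)
  qed
  moreover have "continuous_on D (\<lambda>x. 1 - (norm x)\<^sup>2)" by (intro continuous_intros)
  ultimately obtain p where p: "0 < p" "\<And>x. x \<in> D \<Longrightarrow> p \<le> 1 - (norm x)\<^sup>2"
    using compact_pos_lower_bound[of D "\<lambda>x. 1 - (norm x)\<^sup>2"] by blast
  obtain Q where Q: "0 < Q" "\<And>x. norm (U x) \<le> Q * norm x"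
    using linear_bounded_pos[OF U] by blast
  have UQ: "norm (U x) \<le> Q" if "x \<in> K" for x
    using Q(2)[of x] K1[OF that] Q(1) by (metis mult.right_neutral mult_left_mono order_trans less_imp_le)
  define f where "f t = det (mat 1 + t *\<^sub>R (- matrix U))" for t
  have f': "(f has_real_derivative 0) (at 0)"
    using det_derivative_at_one[of "- matrix U"] trU unfolding f_def by (simp add: trace_def sum_negf)
  have f0: "f 0 = 1" by (simp add: f_def)
  \<comment> \<open>Zero trace makes \<open>f\<close> stationary at 0, so
    \<open>(f t)\<^sup>2\<close> exceeds \<open>1 - t * d\<close> for small \<open>t > 0\<close>;
    minimality will give the reverse inequality.\<close>
  have "((\<lambda>t. (f t)\<^sup>2 - 1 + t * d) has_real_derivative d) (at 0)"
    by (auto intro!: derivative_eq_intros f')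
  then obtain e1 where e1: "0 < e1" "\<And>t. 0 < t \<Longrightarrow> t < e1 \<Longrightarrow> 0 < (f t)\<^sup>2 - 1 + t * d"
    using DERIV_pos_inc_right[of "\<lambda>t. (f t)\<^sup>2 - 1 + t * d" d 0] d f0 by auto
  have "isCont f 0" using f' by (rule DERIV_isCont)
  then have "\<forall>\<^sub>F t in at_right 0. 0 < f t"
    using f0 unfolding isCont_def by (metis filterlim_at_split order_tendstoD(1) zero_less_one)
  moreover have "\<forall>\<^sub>F t in at_right 0. t < e1" "\<forall>\<^sub>F t in at_right 0. t * Q\<^sup>2 < d"
      "\<forall>\<^sub>F t in at_right 0. t * (2 * Q + t * Q\<^sup>2 + d) < p" "\<forall>\<^sub>F t in at_right 0. t * d < 1"
    using e1(1) d p(1)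
    by (auto intro!: order_tendstoD(2)[of _ 0] tendsto_eq_intros)
  moreover have "\<forall>\<^sub>F t in at_right (0::real). 0 < t" by (simp add: eventually_at_right_less)
  ultimately have "\<forall>\<^sub>F t in at_right 0. 0 < t \<and> 0 < f t \<and> t < e1 \<and> t * Q\<^sup>2 < d \<and>
      t * (2 * Q + t * Q\<^sup>2 + d) < p \<and> t * d < 1"
    by eventually_elim auto
  then obtain t where t: "0 < t" "0 < f t" "t < e1" "t * Q\<^sup>2 < d"
      "t * (2 * Q + t * Q\<^sup>2 + d) < p" "t * d < 1"
    using eventually_happens'[OF trivial_limit_at_right_real] by blast
  define S where "S x = x - t *\<^sub>R U x" for x
  have S: "linear S" unfolding S_def
    by (intro linearI) (simp_all add: linear_add[OF U] linear_scale[OF U] algebra_simps)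
  have "matrix S = mat 1 + t *\<^sub>R (- matrix U)"
    by (simp add: vec_eq_iff matrix_def mat_def S_def axis_def)
  then have detS: "det (matrix S) = f t" by (simp add: f_def)
  define r where "r = sqrt (1 - t * d)"
  have r: "0 < r" "r\<^sup>2 = 1 - t * d" "r \<le> 1" using t d by (auto simp: r_def)
  have "norm (S x) \<le> r" if x: "x \<in> K" for x
  proof -
    have Sx: "(norm (S x))\<^sup>2 = (norm x)\<^sup>2 - 2 * t * (x \<bullet> U x) + t\<^sup>2 * (norm (U x))\<^sup>2"
      unfolding power2_norm_eq_inner S_def
      by (simp add: inner_diff_left inner_diff_right inner_commute power2_eq_square algebra_simps)
    have "t\<^sup>2 * (norm (U x))\<^sup>2 \<le> t\<^sup>2 * Q\<^sup>2"
      using UQ[OF x] by (intro mult_left_mono power_mono) auto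
    then have Sx': "(norm (S x))\<^sup>2 \<le> (norm x)\<^sup>2 - 2 * t * (x \<bullet> U x) + t * (t * Q\<^sup>2)"
      unfolding Sx by (simp add: power2_eq_square mult.assoc)
    have "(norm (S x))\<^sup>2 \<le> r\<^sup>2"
    proof (cases "x \<in> D")
      case True
      have "\<bar>x \<bullet> U x\<bar> \<le> 1 * Q"
        using Cauchy_Schwarz_ineq2[of x "U x"] mult_mono[OF K1[OF x] UQ[OF x]] by simp
      then have "t * - (x \<bullet> U x) \<le> t * Q" using t by (intro mult_left_mono) auto
      then show ?thesis using Sx' p(2)[OF True] t(5) r(2) by (simp add: algebra_simps)
    next
      case False
      then have "t * d \<le> t * (x \<bullet> U x)" using x t by (intro mult_left_mono) (auto simp: D_def)
      moreover have "t * (t * Q\<^sup>2) \<le> t * d" using t by (intro mult_left_mono) auto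
      moreover have "(norm x)\<^sup>2 \<le> 1" using K1[OF x] by (simp add: power_le_one)
      ultimately show ?thesis using Sx' r(2) by linarith
    qed
    then show ?thesis by (rule power2_le_imp_le) (use r(1) in simp)
  qed
  then have "\<bar>f t\<bar> \<le> r ^ CARD('n)"
    using min_volume_unit_ball_det[OF min S r(1)] t(2) detS by auto
  \<comment> \<open>One power of \<open>r\<close> is enough, since squaring it already gives
    \<open>1 - t * d\<close>.\<close>
  also have "\<dots> \<le> r ^ 1" using r by (intro power_decreasing) (auto simp: Suc_leI)
  finally have "(f t)\<^sup>2 \<le> r\<^sup>2" using t(2) by (intro power_mono) auto
  then show False using e1(2)[OF t(1,3)] r(2) by simp
qed

section \<open>Projection and gauge\<close>

text \<open>\<open>P\<close> is the identity minus the orthogonal projection onto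
  \<open>span Z\<close>; the rank bound holds because its range and \<open>span Z\<close> together
  span the space.\<close>

lemma orthogonal_projection_along_span:
  fixes Z :: "(real ^ 'n) set"
  assumes "finite Z"
  obtains P where "orthogonal_projection P" "\<And>z. z \<in> Z \<Longrightarrow> P z = 0" "\<And>y. y - P y \<in> span Z"
    "\<And>y. norm (P y) \<le> norm y" "CARD('n) \<le> dim (range P) + card Z"
proof -
  obtain B where B: "B \<subseteq> span Z" "pairwise orthogonal B" "\<And>e. e \<in> B \<Longrightarrow> norm e = 1"
    "independent B" "span B = span Z"
    using orthonormal_basis_subspace[OF subspace_span[of Z]] by metis
  have finB: "finite B" using B(4) by (rule independent_imp_finite)
  define P where "P y = y - (\<Sum>e\<in>B. (y \<bullet> e) *\<^sub>R e)" for y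
  have lin: "linear P" unfolding P_def
    by (intro linearI) (simp_all add: inner_simps algebra_simps sum.distrib scaleR_sum_right)
  have P0: "P z = 0" if "z \<in> span Z" for z
    using orthonormal_basis_expand[OF B(2,3) _ finB, of z] that B(5) by (simp add: P_def)
  have in_span: "y - P y \<in> span Z" for y
    unfolding P_def using B(1) by (auto intro!: span_sum span_scale)
  have idem: "P (P y) = P y" for y
    using P0[OF in_span[of y]] by (simp add: linear_diff[OF lin])
  have sa: "P x \<bullet> y = x \<bullet> P y" for x y
    unfolding P_def by (simp add: inner_diff_left inner_diff_right inner_sum_left inner_sum_right
        inner_commute mult.commute)
  have proj: "orthogonal_projection P"
    unfolding orthogonal_projection_def using lin idem sa by (auto simp: fun_eq_iff)
  have contr: "norm (P y) \<le> norm y" for y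
  proof -
    have "(norm (P y))\<^sup>2 = y \<bullet> P y" unfolding power2_norm_eq_inner sa idem by simp
    also have "\<dots> \<le> norm y * norm (P y)" by (rule norm_cauchy_schwarz)
    finally show ?thesis
      by (cases "norm (P y) = 0") (auto simp: power2_eq_square)
  qed
  have "UNIV = {a + b |a b. a \<in> range P \<and> b \<in> span Z}"
  proof (intro equalityI subsetI)
    fix y
    have "y = P y + (y - P y)" by simp
    then show "y \<in> {a + b |a b. a \<in> range P \<and> b \<in> span Z}" using in_span by blast
  qed simp
  moreover have "subspace (range P)" by (intro linear_subspace_image lin) simp
  ultimately have "dim (UNIV :: (real ^ 'n) set) \<le> dim (range P) + dim (span Z)"
    using dim_sums_Int[of "range P" "span Z"] by simp
  moreover have "dim (span Z) \<le> card Z" using dim_le_card'[OF assms] by simp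
  ultimately have "CARD('n) \<le> dim (range P) + card Z" by simp
  with proj P0 in_span contr show thesis by (intro that[of P]) (auto simp: span_base)
qed

text \<open>Convexity and \<open>0 \<in> D\<close> put every \<open>s > T\<close> into the set
  defining the gauge, so the infimum is over a nonempty set; containment in the unit ball bounds
  this set below by \<open>norm y\<close>.\<close>

lemma minkowski_gauge_bounds:
  fixes D :: "(real ^ 'n) set"
  assumes D: "convex D" "0 \<in> D" "\<And>z. z \<in> D \<Longrightarrow> norm z \<le> 1"
    and T: "0 \<le> T" "z \<in> D" "y = T *\<^sub>R z"
  shows "norm y \<le> minkowski_gauge D y" "minkowski_gauge D y \<le> T"
proof -
  define A where "A = {t. t > 0 \<and> y \<in> (\<lambda>z. t *\<^sub>R z) ` D}"
  \<comment> \<open>\<open>T\<close> may be 0, while the set contains only positive reals; hence the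
    strict inequality, and \<open>dense_ge\<close> at the end.\<close>
  have A: "s \<in> A" if "T < s" for s
  proof -
    have "(1 - T / s) *\<^sub>R 0 + (T / s) *\<^sub>R z \<in> D"
      using D(1,2) T that by (intro convexD) auto
    then have "(T / s) *\<^sub>R z \<in> D" by simp
    moreover have "y = s *\<^sub>R ((T / s) *\<^sub>R z)" using T that by simp
    ultimately have "y \<in> (\<lambda>z. s *\<^sub>R z) ` D" by (rule rev_image_eqI)
    then show ?thesis using T(1) that by (simp add: A_def)
  qed
  have lower: "norm y \<le> s" if s: "s \<in> A" for s
  proof -
    obtain w where w: "w \<in> D" "y = s *\<^sub>R w" "s > 0" using s unfolding A_def by blast
    then show ?thesis using mult_left_mono[OF D(3)[OF w(1)], of s] by simp
  qed
  have "A \<noteq> {}" using A[of "T + 1"] by auto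
  then show "norm y \<le> minkowski_gauge D y"
    unfolding minkowski_gauge_def A_def[symmetric] using lower by (intro cInf_greatest)
  have "bdd_below A" unfolding A_def by (intro bdd_belowI[of _ 0]) auto
  then have "Inf A \<le> s" if "T < s" for s using A[OF that] by (intro cInf_lower)
  then show "minkowski_gauge D y \<le> T"
    unfolding minkowski_gauge_def A_def[symmetric] by (rule dense_ge)
qed

text \<open>Dividing by the sum of the coefficients gives a convex combination; the point 0 absorbs
  the slack up to \<open>T\<close>.\<close>

lemma nonneg_combination_in_multiple:
  fixes v :: "'i \<Rightarrow> 'a::real_vector"
  assumes D: "convex D" "0 \<in> D" and I: "finite I" "\<And>i. i \<in> I \<Longrightarrow> 0 \<le> c i" "\<And>i. i \<in> I \<Longrightarrow> v i \<in> D"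
    and T: "sum c I \<le> T"
  shows "\<exists>w\<in>D. (\<Sum>i\<in>I. c i *\<^sub>R v i) = T *\<^sub>R w"
proof (cases "sum c I = 0")
  case True
  then have "\<forall>i\<in>I. c i = 0" using I by (simp add: sum_nonneg_eq_0_iff)
  then show ?thesis using D(2) by (intro bexI[of _ 0]) auto
next
  case False
  define S where "S = sum c I"
  have S: "0 < S" "S \<le> T" using False I(2) T by (auto simp: S_def less_le sum_nonneg)
  define w where "w = (\<Sum>i\<in>I. (c i / S) *\<^sub>R v i)"
  have "w \<in> D" unfolding w_def
    using D I S by (intro convex_sum) (auto simp: S_def sum_divide_distrib[symmetric])
  then have "(1 - S / T) *\<^sub>R 0 + (S / T) *\<^sub>R w \<in> D"
    using D S by (intro convexD) auto
  moreover have "(\<Sum>i\<in>I. c i *\<^sub>R v i) = T *\<^sub>R ((S / T) *\<^sub>R w)"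
    using S by (simp add: w_def scaleR_sum_right)
  ultimately show ?thesis by (metis add_0 scaleR_zero_right)
qed

text \<open>Substitute for symmetry of \<open>D\<close>: a negative coefficient is turned into a
  positive one at the cost of the factor \<open>R\<close>.\<close>

lemma signed_combination_in_multiple:
  fixes v :: "'i \<Rightarrow> 'a::real_vector"
  assumes D: "convex D" "0 \<in> D" and I: "finite I" "\<And>i. i \<in> I \<Longrightarrow> v i \<in> D"
    and R: "1 \<le> R" "\<And>i. i \<in> I \<Longrightarrow> \<exists>w\<in>D. - v i = R *\<^sub>R w"
  shows "\<exists>w\<in>D. (\<Sum>i\<in>I. a i *\<^sub>R v i) = (R * (\<Sum>i\<in>I. \<bar>a i\<bar>)) *\<^sub>R w"
proof -
  have "\<exists>u\<in>D. a i *\<^sub>R v i = (R * \<bar>a i\<bar>) *\<^sub>R u" if i: "i \<in> I" for i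
  proof (cases "0 \<le> a i")
    case True
    have "(1 - 1 / R) *\<^sub>R 0 + (1 / R) *\<^sub>R v i \<in> D"
      using D I(2)[OF i] R(1) by (intro convexD) auto
    then show ?thesis using True R(1) by (intro bexI[of _ "(1 / R) *\<^sub>R v i"]) auto
  next
    case False
    obtain w where "w \<in> D" "- v i = R *\<^sub>R w" using R(2)[OF i] by blast
    moreover from this have "v i = - (R *\<^sub>R w)" by (metis minus_minus)
    ultimately show ?thesis using False by (intro bexI[of _ w]) auto
  qed
  then obtain u where u: "\<And>i. i \<in> I \<Longrightarrow> u i \<in> D" "\<And>i. i \<in> I \<Longrightarrow> a i *\<^sub>R v i = (R * \<bar>a i\<bar>) *\<^sub>R u i"
    by metis
  have "\<exists>w\<in>D. (\<Sum>i\<in>I. (R * \<bar>a i\<bar>) *\<^sub>R u i) = (R * (\<Sum>i\<in>I. \<bar>a i\<bar>)) *\<^sub>R w"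
    using R(1) by (intro nonneg_combination_in_multiple D I u) (auto simp: sum_distrib_left)
  then show ?thesis using u(2) by simp
qed

text \<open>Coefficients are indexed by \<open>A\<close> rather than by the image, as values of
  \<open>z\<close> may coincide.\<close>

lemma span_image_sum:
  fixes z :: "'i \<Rightarrow> 'a::real_vector"
  assumes "finite A" "t \<in> span (z ` A)"
  obtains b where "t = (\<Sum>g\<in>A. b g *\<^sub>R z g)"
proof -
  let ?S = "range (\<lambda>b. \<Sum>g\<in>A. b g *\<^sub>R z g)"
  have "subspace ?S"
  proof (rule subspaceI)
    show "0 \<in> ?S" by (intro range_eqI[of _ _ "\<lambda>_. 0"]) simp
    fix x y c assume "x \<in> ?S" "y \<in> ?S"
    then obtain b b' where "x = (\<Sum>g\<in>A. b g *\<^sub>R z g)" "y = (\<Sum>g\<in>A. b' g *\<^sub>R z g)" by blast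
    then have "x + y = (\<Sum>g\<in>A. (b g + b' g) *\<^sub>R z g)" "c *\<^sub>R x = (\<Sum>g\<in>A. (c * b g) *\<^sub>R z g)"
      by (simp_all add: scaleR_add_left sum.distrib scaleR_sum_right)
    then show "x + y \<in> ?S" "c *\<^sub>R x \<in> ?S" by (auto intro: range_eqI)
  qed
  moreover have "z ` A \<subseteq> ?S"
  proof
    fix y assume "y \<in> z ` A"
    then obtain h where "h \<in> A" "y = z h" by blast
    then have "y = (\<Sum>g\<in>A. (if g = h then 1 else 0) *\<^sub>R z g)"
      using assms(1) by (simp add: if_distrib[of "\<lambda>c. c *\<^sub>R _"] cong: if_cong)
    then show "y \<in> ?S" by (rule range_eqI[where x = "\<lambda>g. if g = h then 1 else 0"])
  qed
  ultimately have "span (z ` A) \<subseteq> ?S" by (intro span_minimal)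
  then show thesis using assms(2) that by blast
qed

section \<open>Grouping indices by residue class\<close>

lemma sum_lessThan_add: "(\<Sum>i<L + G. f i) = (\<Sum>i<L. f i) + (\<Sum>g<G. f (L + g))"
  for f :: "nat \<Rightarrow> 'a::comm_monoid_add"
  by (induction G) (simp_all add: add.assoc)

lemma card_residue_class_le:
  assumes "0 < (G::nat)"
  shows "card {i. i < L \<and> i mod G = g} \<le> L div G + 1"
proof -
  have "inj_on (\<lambda>i. i div G) {i. i < L \<and> i mod G = g}"
  proof (rule inj_onI)
    fix i j
    assume "i \<in> {i. i < L \<and> i mod G = g}" "j \<in> {i. i < L \<and> i mod G = g}" "i div G = j div G"
    then have "i div G = j div G" "i mod G = j mod G" by auto
    then show "i = j" by (metis div_mult_mod_eq)
  qed
  moreover have "(\<lambda>i. i div G) ` {i. i < L \<and> i mod G = g} \<subseteq> {..L div G}"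
    by (auto intro: div_le_mono)
  ultimately have "card {i. i < L \<and> i mod G = g} \<le> card {..L div G}"
    by (rule card_inj_on_le) simp
  then show ?thesis by simp
qed

text \<open>Split \<open>a i\<close> into \<open>a i - b (i mod G)\<close> and
  \<open>b (i mod G)\<close> with weights \<open>1 + R\<close> and \<open>1 + 1 / R\<close> on the
  squares. Each \<open>b g\<close> occurs at most \<open>R\<close> times, which raises the second
  weight to \<open>1 + R\<close> as well.\<close>

lemma sum_square_le_grouped:
  fixes a b :: "nat \<Rightarrow> real" and R :: real
  assumes G: "0 < G" and R: "0 < R" "\<And>g. g < G \<Longrightarrow> card {i. i < L \<and> i mod G = g} \<le> R"
  shows "(\<Sum>i<L. (a i)\<^sup>2) \<le> (1 + R) * ((\<Sum>i<L. (a i - b (i mod G))\<^sup>2) + (\<Sum>g<G. (b g)\<^sup>2))"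
proof -
  have "(p + q)\<^sup>2 \<le> (1 + R) * p\<^sup>2 + (1 + 1 / R) * q\<^sup>2" for p q :: real
  proof -
    have "0 \<le> (R * p - q)\<^sup>2 / R" using R by simp
    also have "\<dots> = R * p\<^sup>2 - 2 * p * q + q\<^sup>2 / R"
      using R by (simp add: power2_eq_square field_simps)
    finally show ?thesis by (simp add: power2_eq_square algebra_simps)
  qed
  then have "(a i)\<^sup>2 \<le> (1 + R) * (a i - b (i mod G))\<^sup>2 + (1 + 1 / R) * (b (i mod G))\<^sup>2" for i
    by (metis diff_add_cancel)
  then have "(\<Sum>i<L. (a i)\<^sup>2)
      \<le> (\<Sum>i<L. (1 + R) * (a i - b (i mod G))\<^sup>2 + (1 + 1 / R) * (b (i mod G))\<^sup>2)"
    by (rule sum_mono)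
  also have "\<dots> = (1 + R) * (\<Sum>i<L. (a i - b (i mod G))\<^sup>2) + (1 + 1 / R) * (\<Sum>i<L. (b (i mod G))\<^sup>2)"
    by (simp add: sum.distrib sum_distrib_left)
  also have "(\<Sum>i<L. (b (i mod G))\<^sup>2) = (\<Sum>g<G. \<Sum>i\<in>{i \<in> {..<L}. i mod G = g}. (b (i mod G))\<^sup>2)"
    by (rule sum.group[symmetric]) (use G in auto)
  also have "\<dots> = (\<Sum>g<G. card {i. i < L \<and> i mod G = g} * (b g)\<^sup>2)"
    by (intro sum.cong refl) simp
  also have "(1 + 1 / R) * \<dots> \<le> (1 + 1 / R) * (\<Sum>g<G. R * (b g)\<^sup>2)"
    using R by (intro mult_left_mono sum_mono mult_right_mono) auto
  also have "\<dots> = (1 + R) * (\<Sum>g<G. (b g)\<^sup>2)"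
    using R by (simp add: sum_distrib_left[symmetric] field_simps)
  finally show ?thesis by (simp add: algebra_simps)
qed

text \<open>Each residue class of \<open>{..<L}\<close> modulo \<open>G\<close> is joined by one of the \<open>G\<close> extra vectors, and \<open>P\<close>
  annihilates the sum of each enlarged class. Hence \<open>- P (x i)\<close> is the sum of the other members of
  the class of \<open>i\<close>, while discarding the extra vectors keeps the \<open>P (x i)\<close> independent.\<close>

lemma projection_of_grouped_vectors:
  fixes x :: "nat \<Rightarrow> real ^ 'n"
  assumes K: "convex K" "\<And>y. y \<in> K \<Longrightarrow> norm y \<le> 1" "\<And>i. i < L + G \<Longrightarrow> x i \<in> K"
    and s: "0 \<le> s" "\<And>a. s * sqrt (\<Sum>i<L + G. (a i)\<^sup>2) \<le> norm (\<Sum>i<L + G. a i *\<^sub>R x i)"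
    and G: "0 < G" and R: "1 \<le> R" "L / G + 1 \<le> R"
  obtains P where "orthogonal_projection P" "CARD('n) \<le> dim (range P) + G"
    and "\<And>a. s * sqrt (\<Sum>i<L. (a i)\<^sup>2) \<le> sqrt (1 + R) * minkowski_gauge (P ` K) (\<Sum>i<L. a i *\<^sub>R P (x i))"
    and "\<And>a. minkowski_gauge (P ` K) (\<Sum>i<L. a i *\<^sub>R P (x i)) \<le> R * (\<Sum>i<L. \<bar>a i\<bar>)"
proof -
  define I where "I g = {i. i < L \<and> i mod G = g}" for g
  define z where "z g = x (L + g) + (\<Sum>i\<in>I g. x i)" for g
  have I: "finite (I g)" "L + g \<notin> I g" for g by (auto simp: I_def)
  have cardI: "real (card (I g)) \<le> R" for g
  proof -
    have "real (card (I g)) \<le> real (L div G) + 1"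
      unfolding I_def using card_residue_class_le[OF G, of L g] by linarith
    also have "real (L div G) \<le> L / G"
      using G by (simp add: le_divide_eq flip: of_nat_mult)
    finally show ?thesis using R by linarith
  qed
  obtain P where P: "orthogonal_projection P" "\<And>y. y \<in> z ` {..<G} \<Longrightarrow> P y = 0"
    "\<And>y. y - P y \<in> span (z ` {..<G})" "\<And>y. norm (P y) \<le> norm y"
    "CARD('n) \<le> dim (range P) + card (z ` {..<G})"
    using orthogonal_projection_along_span[OF finite_imageI[OF finite_lessThan], of z G] by blast
  have lin: "linear P" using P(1) by (simp add: orthogonal_projection_def)
  let ?D = "P ` K"
  have D: "convex ?D" by (rule convex_linear_image[OF lin K(1)])
  have D1: "norm y \<le> 1" if "y \<in> ?D" for y using that K(2) P(4) order_trans by blast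
  have Pz: "P (x (L + g)) + (\<Sum>i\<in>I g. P (x i)) = 0" if "g < G" for g
    using P(2)[of "z g"] that by (simp add: z_def linear_add[OF lin] linear_sum[OF lin])
  have xD: "P (x i) \<in> ?D" if "i < L + G" for i using K(3)[OF that] by blast
  have D0: "0 \<in> ?D"
  proof -
    \<comment> \<open>The projected vectors of one enlarged class average to 0, which puts 0 into
      \<open>?D\<close>.\<close>
    define J where "J = insert (L + 0) (I 0)"
    have J: "finite J" "(\<Sum>i\<in>J. P (x i)) = 0" "card J > 0"
      using I(1)[of 0] I(2)[of 0] Pz[OF G] by (auto simp: J_def card_gt_0_iff)
    have "(\<Sum>i\<in>J. (1 / real (card J)) *\<^sub>R P (x i)) \<in> ?D"
      using J G by (intro convex_sum D xD) (auto simp: J_def I_def)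
    then show ?thesis using J(2) by (simp add: scaleR_sum_right[symmetric])
  qed
  have neg: "\<exists>w\<in>?D. - P (x i) = R *\<^sub>R w" if i: "i \<in> {..<L}" for i
  proof -
    define g where "g = i mod G"
    \<comment> \<open>The enlarged class without \<open>i\<close>: the extra index replaces
      \<open>i\<close>, so \<open>J\<close> is as large as \<open>I g\<close>.\<close>
    define J where "J = insert (L + g) (I g - {i})"
    have g: "g < G" "i \<in> I g" using G i by (auto simp: g_def I_def)
    have "card J = card (I g)"
      using I(1)[of g] I(2)[of g] g(2) by (simp add: J_def card_gt_0_iff Suc_diff_1 card_Diff_singleton) 
         (metis Suc_pred card_gt_0_iff empty_iff)
    then have "(\<Sum>j\<in>J. 1) \<le> R" using cardI[of g] by simp
    then have "\<exists>w\<in>?D. (\<Sum>j\<in>J. 1 *\<^sub>R P (x j)) = R *\<^sub>R w"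
      using I(1) g by (intro nonneg_combination_in_multiple D D0 xD) (auto simp: J_def I_def)
    moreover have "(\<Sum>j\<in>J. P (x j)) = - P (x i)"
    proof -
      have "(\<Sum>j\<in>I g. P (x j)) = P (x i) + (\<Sum>j\<in>I g - {i}. P (x j))"
        by (rule sum.remove[OF I(1) g(2)])
      moreover have "(\<Sum>j\<in>J. P (x j)) = P (x (L + g)) + (\<Sum>j\<in>I g - {i}. P (x j))"
        unfolding J_def using I by (intro sum.insert) auto
      ultimately show ?thesis using Pz[OF g(1)] by (simp add: add_eq_0_iff algebra_simps)
    qed
    ultimately show ?thesis by simp
  qed
  show thesis
  proof (rule that[of P])
    show "CARD('n) \<le> dim (range P) + G"
      using P(5) card_image_le[of "{..<G}" z] by simp
    fix a :: "nat \<Rightarrow> real"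
    define y where "y = (\<Sum>i<L. a i *\<^sub>R P (x i))"
    have "\<exists>w\<in>?D. y = (R * (\<Sum>i<L. \<bar>a i\<bar>)) *\<^sub>R w"
      unfolding y_def by (intro signed_combination_in_multiple D D0 R neg xD) auto
    then obtain w where w: "w \<in> ?D" "y = (R * (\<Sum>i<L. \<bar>a i\<bar>)) *\<^sub>R w" by blast
    have T: "0 \<le> R * (\<Sum>i<L. \<bar>a i\<bar>)" using R by (simp add: sum_nonneg)
    note gauge = minkowski_gauge_bounds[OF D D0 D1 T w]
    show "minkowski_gauge ?D (\<Sum>i<L. a i *\<^sub>R P (x i)) \<le> R * (\<Sum>i<L. \<bar>a i\<bar>)"
      using gauge(2) by (simp add: y_def)
    define y0 where "y0 = (\<Sum>i<L. a i *\<^sub>R x i)"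
    have y: "y = P y0"
      unfolding y_def y0_def by (simp add: linear_sum[OF lin] linear_scale[OF lin])
    obtain b where b: "y0 - y = (\<Sum>g<G. b g *\<^sub>R z g)"
      using span_image_sum[OF _ P(3)[of y0]] y by auto
    \<comment> \<open>Coefficients of \<open>y\<close> in the original vectors: those of
      \<open>y0\<close> minus those of the kernel part \<open>y0 - y\<close>. The assumed lower
      bound then applies to all \<open>L + G\<close> vectors.\<close>
    define d where "d i = (if i < L then a i - b (i mod G) else - b (i - L))" for i
    have "(\<Sum>g<G. \<Sum>i\<in>{i \<in> {..<L}. i mod G = g}. b (i mod G) *\<^sub>R x i) = (\<Sum>i<L. b (i mod G) *\<^sub>R x i)"
      by (rule sum.group) (use G in auto)
    moreover have "(\<Sum>i\<in>{i \<in> {..<L}. i mod G = g}. b (i mod G) *\<^sub>R x i) = b g *\<^sub>R (\<Sum>i\<in>I g. x i)" for g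
      unfolding scaleR_sum_right by (intro sum.cong) (auto simp: I_def)
    ultimately have "y0 - y = (\<Sum>g<G. b g *\<^sub>R x (L + g)) + (\<Sum>i<L. b (i mod G) *\<^sub>R x i)"
      unfolding b z_def by (simp add: scaleR_add_right sum.distrib)
    moreover have "(\<Sum>i<L + G. d i *\<^sub>R x i) = y0 - (\<Sum>i<L. b (i mod G) *\<^sub>R x i) - (\<Sum>g<G. b g *\<^sub>R x (L + g))"
      unfolding sum_lessThan_add
      by (simp add: d_def y0_def scaleR_diff_left sum_subtractf sum_negf)
    ultimately have dy: "(\<Sum>i<L + G. d i *\<^sub>R x i) = y" by (simp add: algebra_simps)
    have dd: "(\<Sum>i<L + G. (d i)\<^sup>2) = (\<Sum>i<L. (a i - b (i mod G))\<^sup>2) + (\<Sum>g<G. (b g)\<^sup>2)"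
      unfolding sum_lessThan_add by (simp add: d_def)
    have "(\<Sum>i<L. (a i)\<^sup>2) \<le> (1 + R) * (\<Sum>i<L + G. (d i)\<^sup>2)"
      unfolding dd using cardI R(1)
      by (intro sum_square_le_grouped[where a = a and b = b] G) (auto simp: I_def)
    then have "sqrt (\<Sum>i<L. (a i)\<^sup>2) \<le> sqrt (1 + R) * sqrt (\<Sum>i<L + G. (d i)\<^sup>2)"
      unfolding real_sqrt_mult[symmetric] by (rule real_sqrt_le_mono)
    then have "s * sqrt (\<Sum>i<L. (a i)\<^sup>2) \<le> s * (sqrt (1 + R) * sqrt (\<Sum>i<L + G. (d i)\<^sup>2))"
      using s(1) by (rule mult_left_mono)
    also have "\<dots> = sqrt (1 + R) * (s * sqrt (\<Sum>i<L + G. (d i)\<^sup>2))" by simp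
    also have "\<dots> \<le> sqrt (1 + R) * norm y"
      using s(2)[of d] R unfolding dy by (intro mult_left_mono) auto
    also have "\<dots> \<le> sqrt (1 + R) * minkowski_gauge ?D y"
      using gauge(1) R by (intro mult_left_mono) auto
    finally show "s * sqrt (\<Sum>i<L. (a i)\<^sup>2)
        \<le> sqrt (1 + R) * minkowski_gauge ?D (\<Sum>i<L. a i *\<^sub>R P (x i))"
      by (simp add: y_def)
  qed (rule P(1))
qed

section \<open>Choice of the constants and conclusion\<close>

theorem theorem3p4:
  fixes K :: "(real ^ 'n) set" and \<epsilon> :: real
  assumes "convex_body K"
    and "min_volume_ellipsoid (cball 0 1) K"
    and "0 < \<epsilon>" and "\<epsilon> < 1"
  shows "\<exists>(k::nat) (x :: nat \<Rightarrow> real ^ 'n) (P :: real ^ 'n \<Rightarrow> real ^ 'n).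
      int k \<ge> \<lfloor>(1 - \<epsilon>) * real CARD('n)\<rfloor> \<and>
      (\<forall>j\<in>{1..k}. x j \<in> contact_points K (cball 0 1)) \<and>
      orthogonal_projection P \<and> dim (range P) \<ge> k \<and>
      (\<forall>a :: nat \<Rightarrow> real.
         \<epsilon>\<^sup>2 / 16 * sqrt (\<Sum>j=1..k. \<bar>a j\<bar>\<^sup>2)
           \<le> minkowski_gauge (P ` K) (\<Sum>j=1..k. a j *\<^sub>R P (x j)) \<and>
         minkowski_gauge (P ` K) (\<Sum>j=1..k. a j *\<^sub>R P (x j))
           \<le> 4 / \<epsilon> * (\<Sum>j=1..k. \<bar>a j\<bar>))"
proof -
  note \<epsilon> = assms(3,4)
  define n where "n = real CARD('n)"
  have n: "0 < n" by (simp add: n_def)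
  have K: "convex K" "compact K" "K \<noteq> {}"
    using assms(1) interior_subset by (auto simp: convex_body_def)
  have K1: "norm y \<le> 1" if "y \<in> K" for y
    using assms(2) that unfolding min_volume_ellipsoid_def by auto
  define C where "C = K \<inter> sphere 0 1"
  have contact: "u \<in> contact_points K (cball 0 1)" if "u \<in> C" for u
  proof -
    \<comment> \<open>Interior points of \<open>K\<close> lie in the open ball, so a unit vector of
      \<open>K\<close> is on its boundary.\<close>
    have "interior K \<subseteq> interior (cball 0 1)" using K1 by (intro interior_mono) auto
    then have "u \<notin> interior K" using that by (auto simp: C_def)
    moreover have "u \<in> closure K" using that closure_subset by (auto simp: C_def)
    ultimately show ?thesis using that by (simp add: contact_points_def frontier_def C_def)
  qed
  have john: "\<exists>u\<in>C. u \<bullet> T u \<le> operator_trace T / DIM(real ^ 'n)" if "linear T" for T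
    using john_dual[OF K(2) assms(2) that] by (simp add: C_def)
  have unit: "norm u = 1" if "u \<in> C" for u using that by (simp add: C_def)
  show ?thesis
  proof (cases "\<lfloor>(1 - \<epsilon>) * n\<rfloor> \<le> 0")
    case True
    \<comment> \<open>With \<open>k = 0\<close> both estimates concern the gauge of 0, which the
      zero projection makes computable.\<close>
    define P where "P y = (0 :: real ^ 'n)" for y :: "real ^ 'n"
    have "orthogonal_projection P"
      by (auto simp: orthogonal_projection_def P_def fun_eq_iff intro!: linearI)
    moreover have "P ` K = {0}" using K(3) by (auto simp: P_def)
    then have "minkowski_gauge (P ` K) 0 = 0"
      using minkowski_gauge_bounds[of "{0}" 0 0 0] by (auto intro: antisym)
    ultimately show ?thesis
      using True unfolding n_def by (intro exI[of _ "0::nat"] exI[of _ undefined] exI[of _ P]) auto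
  next
    case False
    define L where "L = nat \<lfloor>(1 - \<epsilon>) * n\<rfloor>"
    have floorL: "int L = \<lfloor>(1 - \<epsilon>) * n\<rfloor>" using False by (simp add: L_def)
    have "real L \<le> (1 - \<epsilon>) * n" using of_int_floor_le[of "(1 - \<epsilon>) * n"] floorL by linarith
    then have L: "real L + \<epsilon> * n \<le> n" by (simp add: algebra_simps)
    moreover have "0 < \<epsilon> * n" using \<epsilon> n by simp
    ultimately have Ln: "L < CARD('n)" by (simp add: n_def)
    define m where "m = CARD('n) - L"
    have m: "L + m = DIM(real ^ 'n)" "1 \<le> m" using Ln by (auto simp: m_def)
    have \<epsilon>m: "\<epsilon> * n \<le> m" using L Ln by (simp add: m_def n_def of_nat_diff)
    define G where "G = (m + 1) div 2"
    have G: "0 < G" "G \<le> m" "real m \<le> 2 * real G" using m(2) by (auto simp: G_def)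
    obtain x where x: "\<And>j. j < L + G \<Longrightarrow> x j \<in> C"
      "\<And>a. \<epsilon> * sqrt \<epsilon> / 8 * sqrt (\<Sum>j<L + G. (a j)\<^sup>2) \<le> norm (\<Sum>j<L + G. a j *\<^sub>R x j)"
      using well_conditioned_selection[OF john unit \<epsilon>, of m L] \<epsilon>m m(1)
      unfolding G_def n_def by auto
    \<comment> \<open>\<open>L / G \<le> 2 / \<epsilon>\<close> since
      \<open>\<epsilon> * L \<le> \<epsilon> * n \<le> m \<le> 2 * G\<close>; as
      \<open>\<epsilon> < 1\<close>, even \<open>1 + R\<close> is at most
      \<open>4 / \<epsilon>\<close>.\<close>
    define R where "R = 2 / \<epsilon> + 1"
    have "\<epsilon> * real L \<le> 2 * real G"
    proof -
      have "\<epsilon> * real L \<le> \<epsilon> * n" using \<epsilon> Ln by (intro mult_left_mono) (auto simp: n_def)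
      then show ?thesis using \<epsilon>m G by linarith
    qed
    then have "L / G + 1 \<le> R" using \<epsilon> G by (simp add: R_def field_simps)
    moreover have R: "1 \<le> R" "R \<le> 4 / \<epsilon>" "1 + R \<le> 4 / \<epsilon>"
      using \<epsilon> by (auto simp: R_def field_simps)
    moreover have "0 \<le> \<epsilon> * sqrt \<epsilon> / 8" using \<epsilon> by simp
    moreover have "x i \<in> K" if "i < L + G" for i using x(1)[OF that] by (simp add: C_def)
    ultimately obtain P where P: "orthogonal_projection P" "CARD('n) \<le> dim (range P) + G"
      "\<And>a. \<epsilon> * sqrt \<epsilon> / 8 * sqrt (\<Sum>i<L. (a i)\<^sup>2)
         \<le> sqrt (1 + R) * minkowski_gauge (P ` K) (\<Sum>i<L. a i *\<^sub>R P (x i))"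
      "\<And>a. minkowski_gauge (P ` K) (\<Sum>i<L. a i *\<^sub>R P (x i)) \<le> R * (\<Sum>i<L. \<bar>a i\<bar>)"
      using projection_of_grouped_vectors[OF K(1) K1 _ _ x(2) G(1), of R] by blast
    have lower: "\<epsilon>\<^sup>2 / 16 * sqrt (\<Sum>i<L. (a i)\<^sup>2) \<le> minkowski_gauge (P ` K) (\<Sum>i<L. a i *\<^sub>R P (x i))"
      for a :: "nat \<Rightarrow> real"
    proof -
      define q where "q = sqrt (\<Sum>i<L. (a i)\<^sup>2)"
      define h where "h = minkowski_gauge (P ` K) (\<Sum>i<L. a i *\<^sub>R P (x i))"
      have q: "0 \<le> q" by (simp add: q_def sum_nonneg)
      have h: "\<epsilon> * sqrt \<epsilon> / 8 * q \<le> sqrt (1 + R) * h" using P(3)[of a] by (simp add: q_def h_def)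
      have "0 \<le> sqrt (1 + R) * h" using h q \<epsilon> by (smt (verit) mult_nonneg_nonneg divide_nonneg_pos real_sqrt_ge_zero)
      then have "0 \<le> h" using R(1) by (simp add: zero_le_mult_iff)
      \<comment> \<open>Dividing \<open>\<epsilon> * sqrt \<epsilon> / 8\<close> by
        \<open>2 / sqrt \<epsilon>\<close> produces the constant
        \<open>\<epsilon>\<^sup>2 / 16\<close>.\<close>
      have "sqrt (1 + R) \<le> sqrt (4 / \<epsilon>)" using R(3) by (rule real_sqrt_le_mono)
      then have "sqrt (1 + R) \<le> 2 / sqrt \<epsilon>" by (simp add: real_sqrt_divide)
      then have "\<epsilon> * sqrt \<epsilon> / 8 * q \<le> 2 / sqrt \<epsilon> * h"
        using h \<open>0 \<le> h\<close> by (meson mult_right_mono order_trans)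
      then have "sqrt \<epsilon> / 2 * (\<epsilon> * sqrt \<epsilon> / 8 * q) \<le> sqrt \<epsilon> / 2 * (2 / sqrt \<epsilon> * h)"
        using \<epsilon> by (intro mult_left_mono) auto
      moreover have "sqrt \<epsilon> / 2 * (\<epsilon> * sqrt \<epsilon> / 8 * q) = (sqrt \<epsilon> * sqrt \<epsilon>) * \<epsilon> / 16 * q"
        by simp
      moreover have "(sqrt \<epsilon> * sqrt \<epsilon>) * \<epsilon> = \<epsilon>\<^sup>2"
        using \<epsilon> by (simp add: power2_eq_square)
      moreover have "sqrt \<epsilon> / 2 * (2 / sqrt \<epsilon> * h) = h" using \<epsilon> by simp
      ultimately show ?thesis unfolding q_def[symmetric] h_def[symmetric] by (simp only:)
    qed
    have upper: "minkowski_gauge (P ` K) (\<Sum>i<L. a i *\<^sub>R P (x i)) \<le> 4 / \<epsilon> * (\<Sum>i<L. \<bar>a i\<bar>)"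
      for a :: "nat \<Rightarrow> real"
      by (rule order_trans[OF P(4)]) (intro mult_right_mono R sum_nonneg; simp)
    show ?thesis
    \<comment> \<open>The statement counts from 1, the construction from 0.\<close>
    proof (intro exI[of _ L] exI[of _ "\<lambda>j. x (j - 1)"] exI[of _ P] conjI allI)
      show "\<lfloor>(1 - \<epsilon>) * real CARD('n)\<rfloor> \<le> int L" using floorL by (simp add: n_def)
      show "\<forall>j\<in>{1..L}. x (j - 1) \<in> contact_points K (cball 0 1)"
        using x(1) contact by auto
      show "orthogonal_projection P" by (rule P(1))
      \<comment> \<open>The rank is at least \<open>CARD('n) - G\<close>, and
        \<open>G \<le> m\<close>.\<close>
      show "L \<le> dim (range P)" using P(2) G(2) m(1) by simp
      fix a :: "nat \<Rightarrow> real"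
      show "\<epsilon>\<^sup>2 / 16 * sqrt (\<Sum>j=1..L. \<bar>a j\<bar>\<^sup>2)
          \<le> minkowski_gauge (P ` K) (\<Sum>j=1..L. a j *\<^sub>R P (x (j - 1)))"
        using lower[of "\<lambda>i. a (Suc i)"] by (simp add: sum.atLeast1_atMost_eq)
      show "minkowski_gauge (P ` K) (\<Sum>j=1..L. a j *\<^sub>R P (x (j - 1))) \<le> 4 / \<epsilon> * (\<Sum>j=1..L. \<bar>a j\<bar>)"
        using upper[of "\<lambda>i. a (Suc i)"] by (simp add: sum.atLeast1_atMost_eq)
    qed
  qed
qed

end
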